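(* Let $(S,\mathcal S)$ be a measurable space (an arbitrary non-empty set with a $\sigma$-algebra), $R$ a Markov kernel on $(S,\mathcal S)$ and $U_0$ a probability measure on $(S,\mathcal S)$. Consider the urn model with colors indexed by $S$, replacement kernel $R$ and initial configuration $U_0$, and for $n\ge 0$ let $Z_n$ be the random color of the $(n+1)$-th draw. Let $(X_n)_{n\ge 0}$ be the associated Markov chain on $S$ with transition kernel $R$ and initial distribution $U_0$. Then there exists a nondecreasing sequence $(\tau_n)_{n\ge 0}$ of non-negative integer-valued stopping times with $\tau_0=0$, independent of the Markov chain $(X_n)_{n\ge 0}$, such that for every $n\ge 0$ $$Z_n\stackrel{d}{=}X_{\tau_n}.$$ Moreover, as $n\to\infty$, $$\frac{\tau_n}{\log n}\longrightarrow 1\ \text{ a.s.}\qquad\text{and}\qquad \frac{\tau_n-\log n}{\sqrt{\log n}}\Rightarrow N(0,1).$$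
   Context: A Markov kernel $R$ on $(S,\mathcal S)$ is a map $R:S\times\mathcal S\to[0,1]$ such that $R(s,\cdot)$ is a probability measure for every $s\in S$ and $s\mapsto R(s,A)$ is measurable for every $A\in\mathcal S$. Urn model: given the probability measure $U_0$ (non-random), the random finite measures $U_n$ on $(S,\mathcal S)$ and random colors $Z_n\in S$ are defined recursively for $n\ge 0$ by: conditionally on the past (the previous draws $Z_0,\dots,Z_{n-1}$, hence $U_0,\dots,U_n$), $Z_n$ has distribution $U_n/(n+1)$; and $U_{n+1}(A)=U_n(A)+R(Z_n,A)$ for $A\in\mathcal S$. "Stopping times" independent of the chain: the whole sequence $(\tau_n)_{n\ge0}$ is independent of $(X_n)_{n\ge 0}$, and each $\tau_n$ is a stopping time for the filtration $\mathcal H_k:=\sigma(X_0,\dots,X_k)\vee\sigma(\tau_m: m\ge 0)$, with respect to which $(X_k)$ is still a Markov chain with kernel $R$. $\Rightarrow$ denotes convergence in distribution. *)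

theory Defs
  imports "HOL-Probability.Probability"
begin

definition gen_sigma :: "'a measure \<Rightarrow> 'b measure \<Rightarrow> 'i set \<Rightarrow> ('i \<Rightarrow> 'a \<Rightarrow> 'b) \<Rightarrow> 'a measure" where
  "gen_sigma M S I X = sigma (space M) {X i -` A \<inter> space M | i A. i \<in> I \<and> A \<in> sets S}"

text \<open>Kernels are functions \<open>R\<close> measurable from \<open>S\<close> to \<open>prob_algebra S\<close>: all \<open>R s\<close> are probability
  measures on the \<open>\<sigma>\<close>-algebra of \<open>S\<close>, and all evaluations \<open>s \<mapsto> R s A\<close> are measurable.
  The conditional law of the draw \<open>Z n\<close> is prescribed event by event; the past
  is the \<open>\<sigma>\<close>-algebra of the draws \<open>Z i\<close> with \<open>i < n\<close>, trivial for \<open>n = 0\<close>.\<close>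

definition urn_model ::
  "'a measure \<Rightarrow> 's measure \<Rightarrow> ('s \<Rightarrow> 's measure) \<Rightarrow> 's measure \<Rightarrow>
    (nat \<Rightarrow> 'a \<Rightarrow> 's measure) \<Rightarrow> (nat \<Rightarrow> 'a \<Rightarrow> 's) \<Rightarrow> bool" where
  "urn_model M S R U0 U Z \<longleftrightarrow>
     prob_space M \<and>
     (\<forall>n. Z n \<in> measurable M S) \<and>
     (\<forall>n. \<forall>\<omega>\<in>space M. sets (U n \<omega>) = sets S) \<and>
     (\<forall>\<omega>\<in>space M. U 0 \<omega> = U0) \<and>
     (\<forall>n. \<forall>\<omega>\<in>space M. \<forall>A\<in>sets S.
        emeasure (U (Suc n) \<omega>) A = emeasure (U n \<omega>) A + emeasure (R (Z n \<omega>)) A) \<and>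
     (\<forall>n. \<forall>A\<in>sets S. AE \<omega> in M.
        real_cond_exp M (gen_sigma M S {..<n} Z) (\<lambda>\<omega>. indicator A (Z n \<omega>)) \<omega> =
          measure (U n \<omega>) A / (real n + 1))"

definition markov_chain_wrt ::
  "'a measure \<Rightarrow> (nat \<Rightarrow> 'a measure) \<Rightarrow> 's measure \<Rightarrow> ('s \<Rightarrow> 's measure) \<Rightarrow> 's measure \<Rightarrow>
    (nat \<Rightarrow> 'a \<Rightarrow> 's) \<Rightarrow> bool" where
  "markov_chain_wrt N F S R \<mu> X \<longleftrightarrow>
     prob_space N \<and>
     filtration (space N) F \<and>
     (\<forall>k. subalgebra N (F k)) \<and>
     (\<forall>k. X k \<in> measurable (F k) S) \<and>
     distr N S (X 0) = \<mu> \<and>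
     (\<forall>k. \<forall>A\<in>sets S. AE \<omega> in N.
        real_cond_exp N (F k) (\<lambda>\<omega>. indicator A (X (Suc k) \<omega>)) \<omega> = measure (R (X k \<omega>)) A)"

definition markov_chain ::
  "'a measure \<Rightarrow> 's measure \<Rightarrow> ('s \<Rightarrow> 's measure) \<Rightarrow> 's measure \<Rightarrow> (nat \<Rightarrow> 'a \<Rightarrow> 's) \<Rightarrow> bool" where
  "markov_chain N S R \<mu> X \<longleftrightarrow> markov_chain_wrt N (\<lambda>k. gen_sigma N S {..k} X) S R \<mu> X"

definition enlarged_filtration ::
  "'a measure \<Rightarrow> 's measure \<Rightarrow> (nat \<Rightarrow> 'a \<Rightarrow> 's) \<Rightarrow> (nat \<Rightarrow> 'a \<Rightarrow> nat) \<Rightarrow> nat \<Rightarrow> 'a measure" where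
  "enlarged_filtration N S X \<tau> k =
     sigma (space N) (sets (gen_sigma N S {..k} X) \<union> sets (gen_sigma N (count_space UNIV) UNIV \<tau>))"

text \<open>The library's \<open>indep_var\<close> needs both variables to have the same value type, hence the
  formulation through generated \<open>\<sigma>\<close>-algebras.\<close>

definition indep_sequences ::
  "'a measure \<Rightarrow> 's measure \<Rightarrow> (nat \<Rightarrow> 'a \<Rightarrow> 's) \<Rightarrow> 't measure \<Rightarrow> (nat \<Rightarrow> 'a \<Rightarrow> 't) \<Rightarrow> bool" where
  "indep_sequences N S X T Y \<longleftrightarrow>
     prob_space.indep_set N (sets (gen_sigma N S UNIV X)) (sets (gen_sigma N T UNIV Y))"

text \<open>\<open>N'\<close> is an extension of the probability space \<open>N\<close>: random variables \<open>X\<close> on \<open>N\<close>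
  are identified with \<open>X \<circ> \<pi>\<close> on \<open>N'\<close>.\<close>

definition prob_extension :: "'a measure \<Rightarrow> 'b measure \<Rightarrow> ('b \<Rightarrow> 'a) \<Rightarrow> bool" where
  "prob_extension N N' \<pi> \<longleftrightarrow> prob_space N' \<and> \<pi> \<in> measurable N' N \<and> distr N' N \<pi> = N"

end

theory Submission
  imports Defs "HOL-Real_Asymp.Real_Asymp"
begin

text \<open>Averaging \<open>U (n + 1) = U n + R (Z n)\<close> shows that the law \<open>\<mu> n\<close> of \<open>Z n\<close> satisfies
  \<open>\<mu> (n + 1) = (1 - 1 / (n + 2)) \<mu> n + 1 / (n + 2) \<mu> n R\<close>: with probability \<open>1 / (n + 2)\<close> one more step of
  the chain is made. Hence \<open>\<tau> n\<close> can be the number of successes among the first \<open>n\<close> of a sequence of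
  independent coins, independent of the chain, where coin \<open>i\<close> shows success with probability \<open>1 / (i + 2)\<close>.
  Both the mean \<open>m n\<close> of \<open>\<tau> n\<close> and the bound \<open>m n\<close> on its variance are \<open>ln n + O(1)\<close>.
  The second moments of \<open>(\<tau> n - m n) / k\<^sup>2\<close> along \<open>n = 2 ^ k\<^sup>2\<close> are therefore summable, and monotonicity
  of \<open>\<tau>\<close> extends the almost sure limit to all \<open>n\<close>. The central limit theorem follows from
  Levy's continuity theorem by comparing the characteristic function of \<open>\<tau> n\<close> with the Poisson one.\<close>

section \<open>Independent coins\<close>

text \<open>The 0/1 outcome is stored as a natural number because the conclusion asks for an
  extension space over \<open>'b \<times> (nat \<Rightarrow> nat)\<close>.\<close>

definition coins :: "nat \<Rightarrow> nat measure" where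
  "coins i = measure_pmf (map_pmf of_bool (bernoulli_pmf (1 / (real i + 2))))"

definition coin_space :: "(nat \<Rightarrow> nat) measure" where
  "coin_space = Pi\<^sub>M UNIV coins"

text \<open>Testing for a nonzero coordinate, rather than adding the coordinates, keeps every
  increment at most 1 at all points; the bound \<open>successes_le\<close> then holds everywhere and
  not just almost surely.\<close>

definition successes :: "nat \<Rightarrow> (nat \<Rightarrow> nat) \<Rightarrow> nat" where
  "successes n \<omega> = (\<Sum>i<n. of_bool (\<omega> i \<noteq> 0))"

definition mean_successes :: "nat \<Rightarrow> real" where
  "mean_successes n = (\<Sum>i<n. 1 / (real i + 2))"

lemma sets_coins [measurable_cong, simp]: "sets (coins i) = sets (count_space UNIV)"
  by (simp add: coins_def)

lemma prob_space_coins: "prob_space (coins i)"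
  unfolding coins_def by (rule prob_space_measure_pmf)

interpretation coins: product_prob_space coins I for I :: "nat set"
proof -
  interpret prob_space "coins i" for i by (rule prob_space_coins)
  show "product_prob_space coins" by unfold_locales
qed

interpretation coin_space: prob_space coin_space
  unfolding coin_space_def by (rule prob_space_PiM) (rule prob_space_coins)

lemma measurable_successes_PiM:
  assumes "{..<n} \<subseteq> I"
  shows "successes n \<in> measurable (Pi\<^sub>M I coins) (count_space UNIV)"
proof -
  have "(\<lambda>\<omega>. of_bool (\<omega> i \<noteq> (0::nat)) :: nat) \<in> measurable (Pi\<^sub>M I coins) (count_space UNIV)" if "i < n" for i
    proof -
    have [measurable]: "(\<lambda>\<omega>. \<omega> i) \<in> measurable (Pi\<^sub>M I coins) (coins i)"
      using that assms by (intro measurable_component_singleton) auto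
    show ?thesis by measurable
  qed
  then have "(\<lambda>\<omega>. \<Sum>i<n. of_bool (\<omega> i \<noteq> 0) :: nat) \<in> measurable (Pi\<^sub>M I coins) (count_space UNIV)"
    by measurable
  then show ?thesis by (simp add: successes_def[abs_def])
qed

lemma measurable_successes [measurable]: "successes n \<in> measurable coin_space (count_space UNIV)"
  unfolding coin_space_def by (rule measurable_successes_PiM) simp

lemma successes_0 [simp]: "successes 0 \<omega> = 0"
  by (simp add: successes_def)

lemma mono_successes: "mono (\<lambda>n. successes n \<omega>)"
  unfolding successes_def by (intro monoI sum_mono2) auto

lemma successes_le: "successes n \<omega> \<le> n"
proof -
  have "successes n \<omega> \<le> (\<Sum>i<n. 1)" unfolding successes_def by (intro sum_mono) auto
  then show ?thesis by simp
qed

text \<open>The values of \<open>successes n\<close> lie in \<open>{..n}\<close>, so an arbitrary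
  \<open>g\<close> is bounded along it. This settles integrability for every \<open>g\<close>,
  whatever its growth.\<close>

lemma norm_comp_successes_le:
  fixes g :: "nat \<Rightarrow> 'c :: real_normed_vector"
  shows "norm (g (successes n \<omega>)) \<le> (\<Sum>k\<le>n. norm (g k))"
  using successes_le[of n \<omega>] by (intro member_le_sum) auto

lemma integrable_successes [simp]:
  fixes g :: "nat \<Rightarrow> 'c :: {banach, second_countable_topology}"
  shows "integrable coin_space (\<lambda>\<omega>. g (successes n \<omega>))"
  by (rule coin_space.integrable_const_bound[where B="\<Sum>k\<le>n. norm (g k)"])
     (auto intro!: norm_comp_successes_le)

text \<open>Only the coordinates below \<open>n\<close> are read, so restricting to a finite
  \<open>J\<close> changes nothing. The finite product prepares for Fubini's theorem one coordinate
  at a time.\<close>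

lemma integral_successes_PiM:
  fixes g :: "nat \<Rightarrow> 'c :: {banach, second_countable_topology}"
  assumes "{..<n} \<subseteq> J" "finite J"
  shows "(\<integral>\<omega>. g (successes n \<omega>) \<partial>coin_space) = (\<integral>\<omega>. g (successes n \<omega>) \<partial>Pi\<^sub>M J coins)"
proof -
  have [measurable]: "successes n \<in> measurable (Pi\<^sub>M J coins) (count_space UNIV)"
    using assms(1) by (rule measurable_successes_PiM)
  have "(\<integral>\<omega>. g (successes n \<omega>) \<partial>Pi\<^sub>M J coins) =
      (\<integral>\<omega>. g (successes n \<omega>) \<partial>distr (Pi\<^sub>M UNIV coins) (Pi\<^sub>M J coins) (\<lambda>x. restrict x J))"
    using assms by (subst coins.distr_PiM_restrict_finite) auto
  also have "\<dots> = (\<integral>\<omega>. g (successes n (restrict \<omega> J)) \<partial>Pi\<^sub>M UNIV coins)"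
    by (rule integral_distr) measurable
  also have "\<dots> = (\<integral>\<omega>. g (successes n \<omega>) \<partial>coin_space)"
  proof -
    have "successes n (restrict \<omega> J) = successes n \<omega>" for \<omega>
      unfolding successes_def using assms by (intro sum.cong) auto
    then show ?thesis by (simp add: coin_space_def)
  qed
  finally show ?thesis by simp
qed

text \<open>Conditioning on coin \<open>n\<close>, which is independent of the earlier ones. The
  values lie in a Banach space so that one recursion serves the mean, the variance, the complex
  characteristic function and the law of the chain at time \<open>successes n\<close>.\<close>

lemma expectation_successes_Suc:
  fixes g :: "nat \<Rightarrow> 'c :: {banach, second_countable_topology}"
  shows "(\<integral>\<omega>. g (successes (Suc n) \<omega>) \<partial>coin_space) =
    (1 - 1 / (real n + 2)) *\<^sub>R (\<integral>\<omega>. g (successes n \<omega>) \<partial>coin_space) +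
    (1 / (real n + 2)) *\<^sub>R (\<integral>\<omega>. g (Suc (successes n \<omega>)) \<partial>coin_space)"
proof -
  let ?p = "1 / (real n + 2)"
  have [measurable]: "successes n \<in> measurable (Pi\<^sub>M {..<n} coins) (count_space UNIV)"
      "successes (Suc n) \<in> measurable (Pi\<^sub>M (insert n {..<n}) coins) (count_space UNIV)"
    by (auto intro: measurable_successes_PiM)
  have P: "finite_measure (Pi\<^sub>M I coins)" for I
    by (intro prob_space.finite_measure prob_space_PiM prob_space_coins)
  have int: "integrable (Pi\<^sub>M {..<n} coins) (\<lambda>\<omega>. h (successes n \<omega>))" for h :: "nat \<Rightarrow> 'c"
    by (rule finite_measure.integrable_const_bound[OF P, where B="\<Sum>k\<le>n. norm (h k)"])
       (auto intro!: norm_comp_successes_le)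
  have int': "integrable (Pi\<^sub>M (insert n {..<n}) coins) (\<lambda>\<omega>. h (successes (Suc n) \<omega>))" for h :: "nat \<Rightarrow> 'c"
    by (rule finite_measure.integrable_const_bound[OF P, where B="\<Sum>k\<le>Suc n. norm (h k)"])
       (auto intro!: norm_comp_successes_le simp del: sum.atMost_Suc)
  have upd: "successes (Suc n) (fun_upd \<omega> n y) = successes n \<omega> + of_bool (y \<noteq> 0)" for \<omega> y
    by (simp add: successes_def)
  have inner: "(\<integral>y. g (k + of_bool (y \<noteq> 0)) \<partial>coins n) = (1 - ?p) *\<^sub>R g k + ?p *\<^sub>R g (Suc k)" for k
    by (simp add: coins_def integral_measure_pmf[where A=UNIV] UNIV_bool)
  have "(\<integral>\<omega>. g (successes (Suc n) \<omega>) \<partial>coin_space) =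
      (\<integral>\<omega>. g (successes (Suc n) \<omega>) \<partial>Pi\<^sub>M (insert n {..<n}) coins)"
    by (rule integral_successes_PiM) auto
  also have "\<dots> = (\<integral>\<omega>. (\<integral>y. g (successes (Suc n) (fun_upd \<omega> n y)) \<partial>coins n) \<partial>Pi\<^sub>M {..<n} coins)"
    by (rule coins.product_integral_insert) (auto intro: int')
  also have "\<dots> = (\<integral>\<omega>. (1 - ?p) *\<^sub>R g (successes n \<omega>) + ?p *\<^sub>R g (Suc (successes n \<omega>)) \<partial>Pi\<^sub>M {..<n} coins)"
    by (simp only: upd inner)
  also have "\<dots> = (1 - ?p) *\<^sub>R (\<integral>\<omega>. g (successes n \<omega>) \<partial>Pi\<^sub>M {..<n} coins) +
      ?p *\<^sub>R (\<integral>\<omega>. g (Suc (successes n \<omega>)) \<partial>Pi\<^sub>M {..<n} coins)"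
    using int[of g] int[of "\<lambda>k. g (Suc k)"] by simp
  also have "\<dots> = (1 - ?p) *\<^sub>R (\<integral>\<omega>. g (successes n \<omega>) \<partial>coin_space) +
      ?p *\<^sub>R (\<integral>\<omega>. g (Suc (successes n \<omega>)) \<partial>coin_space)"
    using integral_successes_PiM[of n "{..<n}" g] integral_successes_PiM[of n "{..<n}" "\<lambda>k. g (Suc k)"] by simp
  finally show ?thesis .
qed

section \<open>Mean and variance of the number of successes, and their logarithmic growth\<close>

lemma mean_successes_Suc: "mean_successes (Suc n) = mean_successes n + 1 / (real n + 2)"
  by (simp add: mean_successes_def)

lemma expectation_successes: "(\<integral>\<omega>. real (successes n \<omega>) \<partial>coin_space) = mean_successes n"
proof (induction n)
  case (Suc n)
  show ?case
    using Suc
    by (subst expectation_successes_Suc)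
       (simp add: mean_successes_Suc algebra_simps coin_space.prob_space add_divide_distrib)
qed (simp add: mean_successes_def)

text \<open>The exact increment of the variance is \<open>p * (1 - p)\<close> with
  \<open>p = 1 / (n + 2)\<close>; bounding the factor \<open>1 - p\<close> by 1 leaves the increment
  of the mean.\<close>

lemma variance_successes_le:
  "(\<integral>\<omega>. (real (successes n \<omega>) - mean_successes n)\<^sup>2 \<partial>coin_space) \<le> mean_successes n"
proof (induction n)
  case (Suc n)
  let ?p = "1 / (real n + 2)" and ?m = "mean_successes n"
  let ?Y = "\<lambda>\<omega>. real (successes n \<omega>) - ?m"
  have I: "integrable coin_space (\<lambda>\<omega>. (?Y \<omega>)\<^sup>2)" "integrable coin_space ?Y"
    using integrable_successes[of "\<lambda>k. (real k - ?m)\<^sup>2" n] integrable_successes[of "\<lambda>k. real k - ?m" n]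
    by auto
  have 0: "(\<integral>\<omega>. ?Y \<omega> \<partial>coin_space) = 0"
    using integrable_successes[of real n]
    by (simp add: expectation_successes coin_space.prob_space)
  \<comment> \<open>\<open>?Y\<close> is centred, so the cross term vanishes when the square is
    expanded.\<close>
  have shift: "(\<integral>\<omega>. (?Y \<omega> + c)\<^sup>2 \<partial>coin_space) = (\<integral>\<omega>. (?Y \<omega>)\<^sup>2 \<partial>coin_space) + c\<^sup>2" for c
  proof -
    have "(\<integral>\<omega>. (?Y \<omega> + c)\<^sup>2 \<partial>coin_space) = (\<integral>\<omega>. (?Y \<omega>)\<^sup>2 + (2 * c) * ?Y \<omega> + c\<^sup>2 \<partial>coin_space)"
      by (intro Bochner_Integration.integral_cong) (auto simp: power2_eq_square algebra_simps)
    also have "\<dots> = (\<integral>\<omega>. (?Y \<omega>)\<^sup>2 \<partial>coin_space) + (\<integral>\<omega>. (2 * c) * ?Y \<omega> \<partial>coin_space) + c\<^sup>2"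
      using I by (subst Bochner_Integration.integral_add; simp add: coin_space.prob_space)+
    finally show ?thesis using 0 by simp
  qed
  \<comment> \<open>The mean grows by \<open>?p\<close>, so the recentred variable is
    \<open>?Y - ?p\<close> after a failure and \<open>?Y + (1 - ?p)\<close> after a success.\<close>
  have "(\<integral>\<omega>. (real (successes (Suc n) \<omega>) - mean_successes (Suc n))\<^sup>2 \<partial>coin_space) =
      (1 - ?p) * (\<integral>\<omega>. (?Y \<omega> + (- ?p))\<^sup>2 \<partial>coin_space) + ?p * (\<integral>\<omega>. (?Y \<omega> + (1 - ?p))\<^sup>2 \<partial>coin_space)"
    by (subst expectation_successes_Suc) (simp add: mean_successes_Suc algebra_simps)
  also have "\<dots> = (\<integral>\<omega>. (?Y \<omega>)\<^sup>2 \<partial>coin_space) + ?p * (1 - ?p)"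
    unfolding shift by (simp only: power2_eq_square) algebra
  also have "\<dots> \<le> ?m + ?p"
  proof (rule add_mono)
    show "?p * (1 - ?p) \<le> ?p" by (rule mult_left_le) auto
  qed (rule Suc.IH)
  finally show ?case by (simp add: mean_successes_Suc)
qed (simp add: mean_successes_def)

text \<open>Each increment is compared with \<open>ln (n + 2) - ln (n + 1)\<close> through
  \<open>ln x \<le> x - 1\<close>. This explicit bound feeds the second moments in
  \<open>AE_successes_over_ln\<close>.\<close>

lemma mean_successes_le_ln: "mean_successes n \<le> ln (real n + 1)"
proof (induction n)
  case (Suc n)
  have "ln ((real n + 1) / (real n + 2)) \<le> (real n + 1) / (real n + 2) - 1"
    by (rule ln_le_minus_one) auto
  also have "\<dots> = - (1 / (real n + 2))" by (simp add: field_simps)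
  finally have "1 / (real n + 2) \<le> ln (real n + 2) - ln (real n + 1)"
    by (simp add: ln_div)
  with Suc show ?case by (simp add: mean_successes_Suc add.commute)
qed (simp add: mean_successes_def)

lemma mean_successes_conv_harm: "mean_successes n = harm (Suc n) - 1"
proof (induction n)
  case (Suc n)
  then show ?case by (simp add: mean_successes_Suc harm_Suc[of "Suc n"] inverse_eq_divide add.commute)
qed (simp add: mean_successes_def harm_def)

text \<open>By \<open>mean_successes_conv_harm\<close> this is the convergence to the
  Euler-Mascheroni constant, shifted by 1. The existence of a finite limit is what lets
  \<open>ln n\<close> replace the mean as centering.\<close>

lemma mean_successes_minus_ln: "convergent (\<lambda>n. mean_successes n - ln (real n))"
proof -
  obtain c where c: "(\<lambda>n. harm n - ln (real n)) \<longlonglongrightarrow> (c::real)"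
    using euler_mascheroni_convergent by (auto simp: convergent_def)
  have l: "(\<lambda>n. ln (real (Suc n)) - ln (real n) - 1) \<longlonglongrightarrow> -1" by real_asymp
  have "(\<lambda>n. (harm (Suc n) - ln (real (Suc n))) + (ln (real (Suc n)) - ln (real n) - 1)) \<longlonglongrightarrow> c + (-1)"
    by (intro tendsto_add LIMSEQ_Suc[OF c] l)
  moreover have "(harm (Suc n) - ln (real (Suc n))) + (ln (real (Suc n)) - ln (real n) - 1) =
      mean_successes n - ln (real n)" for n
    by (simp add: mean_successes_conv_harm)
  ultimately show ?thesis
    by (auto simp only: convergent_def)
qed

lemma mean_successes_asymp: "(\<lambda>n. mean_successes n / ln (real n)) \<longlonglongrightarrow> 1"
proof -
  obtain c where c: "(\<lambda>n. mean_successes n - ln (real n)) \<longlonglongrightarrow> c"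
    using mean_successes_minus_ln by (auto simp: convergent_def)
  have "filterlim (\<lambda>n. ln (real n)) at_top sequentially" by real_asymp
  then have "(\<lambda>n. (mean_successes n - ln (real n)) / ln (real n)) \<longlonglongrightarrow> 0"
    by (intro real_tendsto_divide_at_top[OF c])
  then have "(\<lambda>n. (mean_successes n - ln (real n)) / ln (real n) + 1) \<longlonglongrightarrow> 0 + 1"
    by (intro tendsto_intros)
  moreover have "\<forall>\<^sub>F n in sequentially. (mean_successes n - ln (real n)) / ln (real n) + 1 = mean_successes n / ln (real n)"
    using eventually_gt_at_top[of 1] by eventually_elim (auto simp: field_simps)
  ultimately show ?thesis by (simp add: tendsto_cong)
qed

section \<open>The almost sure limit, along a subsequence and then in full\<close>

lemma AE_tendsto_zero_if_second_moments_summable: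
  fixes Y :: "nat \<Rightarrow> 'a \<Rightarrow> real"
  assumes int: "\<And>k. integrable M (\<lambda>\<omega>. (Y k \<omega>)\<^sup>2)"
    and le: "\<And>k. (\<integral>\<omega>. (Y k \<omega>)\<^sup>2 \<partial>M) \<le> b k" and sum: "summable b"
  shows "AE \<omega> in M. (\<lambda>k. Y k \<omega>) \<longlonglongrightarrow> 0"
proof -
  have [measurable]: "(\<lambda>\<omega>. (Y k \<omega>)\<^sup>2) \<in> borel_measurable M" for k
    using int[of k] by auto
  have b: "0 \<le> b k" for k
    by (rule order_trans[OF Bochner_Integration.integral_nonneg le]) simp
  \<comment> \<open>Exchanging sum and integral shows that the random series of squares has finite
    expectation; it is therefore finite almost surely, and its terms tend to 0.\<close>
  have "(\<integral>\<^sup>+\<omega>. (\<Sum>k. ennreal ((Y k \<omega>)\<^sup>2)) \<partial>M) = (\<Sum>k. \<integral>\<^sup>+\<omega>. ennreal ((Y k \<omega>)\<^sup>2) \<partial>M)"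
    by (rule nn_integral_suminf) measurable
  also have "\<dots> \<le> (\<Sum>k. ennreal (b k))"
    using int le by (intro suminf_le) (auto simp: nn_integral_eq_integral intro!: ennreal_leI)
  also have "\<dots> = ennreal (suminf b)" using b sum by (intro suminf_ennreal2) auto
  finally have "(\<integral>\<^sup>+\<omega>. (\<Sum>k. ennreal ((Y k \<omega>)\<^sup>2)) \<partial>M) \<noteq> \<infinity>"
    by (auto simp: top_unique)
  then have "AE \<omega> in M. (\<Sum>k. ennreal ((Y k \<omega>)\<^sup>2)) \<noteq> \<infinity>"
    by (rule nn_integral_PInf_AE[rotated]) measurable
  then show ?thesis
  proof eventually_elim
    fix \<omega> assume "(\<Sum>k. ennreal ((Y k \<omega>)\<^sup>2)) \<noteq> \<infinity>"
    then have "summable (\<lambda>k. (Y k \<omega>)\<^sup>2)"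
      by (intro summable_suminf_not_top) auto
    then have "(\<lambda>k. (Y k \<omega>)\<^sup>2) \<longlonglongrightarrow> 0" by (rule summable_LIMSEQ_zero)
    then have "(\<lambda>k. sqrt ((Y k \<omega>)\<^sup>2)) \<longlonglongrightarrow> sqrt 0" by (rule tendsto_real_sqrt)
    then show "(\<lambda>k. Y k \<omega>) \<longlonglongrightarrow> 0" by (simp add: tendsto_rabs_zero_iff)
  qed
qed

text \<open>Monotonicity of \<open>a\<close> traps \<open>a n\<close> between its values at
  consecutive points \<open>2 ^ k\<^sup>2\<close>. The logarithms of these points are
  \<open>k\<^sup>2 * ln 2\<close>, and the ratio of consecutive ones tends to 1, so both bounds have
  the same limit; \<open>ln 2\<close> remains from the change of normalization.\<close>

lemma tendsto_over_ln_of_subsequence: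
  fixes a :: "nat \<Rightarrow> real"
  assumes mono: "mono a" and nonneg: "\<And>n. 0 \<le> a n"
    and lim: "(\<lambda>k. a (2 ^ k\<^sup>2) / real (k\<^sup>2)) \<longlonglongrightarrow> c"
  shows "(\<lambda>n. a n / ln (real n)) \<longlonglongrightarrow> c / ln 2"
proof -
  \<comment> \<open>For \<open>n \<ge> 1\<close> this is the largest \<open>k\<close> with
    \<open>2 ^ k\<^sup>2 \<le> n\<close>, found by solving for \<open>k\<close>.\<close>
  define K where "K n = nat \<lfloor>sqrt (log 2 (real n))\<rfloor>" for n
  have K: "filterlim K at_top sequentially"
    unfolding K_def by real_asymp
  have bounds: "2 ^ (K n)\<^sup>2 \<le> n" "n \<le> 2 ^ (Suc (K n))\<^sup>2" if n: "n \<ge> 1" for n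
  proof -
    let ?l = "log 2 (real n)"
    have l: "0 \<le> ?l" using n by simp
    have k1: "real (K n) \<le> sqrt ?l" using l by (simp add: K_def)
    have "(real (K n))\<^sup>2 \<le> (sqrt ?l)\<^sup>2" using k1 by (intro power_mono) auto
    then have "real ((K n)\<^sup>2) \<le> ?l" using l by simp
    then have "2 powr real ((K n)\<^sup>2) \<le> 2 powr ?l" by (intro powr_mono) auto
    then have "real (2 ^ (K n)\<^sup>2) \<le> real n" using n by (simp only: powr_realpow[of 2]) simp
    then show "2 ^ (K n)\<^sup>2 \<le> n" by (simp only: of_nat_le_iff)
    have k2: "sqrt ?l \<le> real (Suc (K n))" using l unfolding K_def by simp linarith
    have "(sqrt ?l)\<^sup>2 \<le> (real (Suc (K n)))\<^sup>2" using k2 l by (intro power_mono) auto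
    then have "?l \<le> real ((Suc (K n))\<^sup>2)" using l by simp
    then have "2 powr ?l \<le> 2 powr real ((Suc (K n))\<^sup>2)" by (intro powr_mono) auto
    then have "real n \<le> real (2 ^ (Suc (K n))\<^sup>2)" using n by (simp only: powr_realpow[of 2]) simp
    then show "n \<le> 2 ^ (Suc (K n))\<^sup>2" by (simp only: of_nat_le_iff)
  qed
  define L where "L k = a (2 ^ k\<^sup>2) / real (k\<^sup>2)" for k
  have L: "L \<longlonglongrightarrow> c" using lim by (simp add: L_def[abs_def])
  \<comment> \<open>The quotients of squares in \<open>lo\<close> and \<open>hi\<close> trade the
    denominator in \<open>L\<close> for that of the opposite end of the block; they tend to
    1.\<close>
  have lo: "(\<lambda>k. L k * (real (k\<^sup>2) / real ((Suc k)\<^sup>2)) / ln 2) \<longlonglongrightarrow> c * 1 / ln 2"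
    by (intro tendsto_intros L) (simp_all, real_asymp)
  have hi: "(\<lambda>k. L (Suc k) * (real ((Suc k)\<^sup>2) / real (k\<^sup>2)) / ln 2) \<longlonglongrightarrow> c * 1 / ln 2"
    by (intro tendsto_intros LIMSEQ_Suc[OF L]) (simp_all, real_asymp)
  \<comment> \<open>These bounds keep the denominators \<open>(K n)\<^sup>2\<close> and
    \<open>ln n\<close> positive.\<close>
  have ev: "\<forall>\<^sub>F n in sequentially. K n \<ge> 1 \<and> n \<ge> 2"
    using K eventually_ge_at_top[of 2] by (auto simp: filterlim_at_top intro: eventually_conj)
  have ln_lo: "real ((K n)\<^sup>2) * ln 2 \<le> ln (real n)" and ln_hi: "ln (real n) \<le> real ((Suc (K n))\<^sup>2) * ln 2"
    if "n \<ge> 2" for n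
  proof -
    have "ln (real (2 ^ (K n)\<^sup>2)) \<le> ln (real n)" "ln (real n) \<le> ln (real (2 ^ (Suc (K n))\<^sup>2))"
      using bounds[of n] that by (auto simp del: of_nat_power simp: ln_le_cancel_iff)
    then show "real ((K n)\<^sup>2) * ln 2 \<le> ln (real n)" "ln (real n) \<le> real ((Suc (K n))\<^sup>2) * ln 2"
      by (simp_all add: ln_realpow)
  qed
  show ?thesis
  proof (rule tendsto_sandwich)
    show "\<forall>\<^sub>F n in sequentially. L (K n) * (real ((K n)\<^sup>2) / real ((Suc (K n))\<^sup>2)) / ln 2 \<le> a n / ln (real n)"
      using ev
    proof eventually_elim
      fix n assume n: "K n \<ge> 1 \<and> n \<ge> 2"
      have "L (K n) * (real ((K n)\<^sup>2) / real ((Suc (K n))\<^sup>2)) / ln 2 = a (2 ^ (K n)\<^sup>2) / (real ((Suc (K n))\<^sup>2) * ln 2)"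
        using n by (simp add: L_def)
      also have "\<dots> \<le> a n / ln (real n)"
        using n bounds[of n] ln_hi[of n] nonneg mono by (intro frac_le) (auto simp: mono_def)
      finally show "L (K n) * (real ((K n)\<^sup>2) / real ((Suc (K n))\<^sup>2)) / ln 2 \<le> a n / ln (real n)" .
    qed
    show "\<forall>\<^sub>F n in sequentially. a n / ln (real n) \<le> L (Suc (K n)) * (real ((Suc (K n))\<^sup>2) / real ((K n)\<^sup>2)) / ln 2"
      using ev
    proof eventually_elim
      fix n assume n: "K n \<ge> 1 \<and> n \<ge> 2"
      have "a n / ln (real n) \<le> a (2 ^ (Suc (K n))\<^sup>2) / (real ((K n)\<^sup>2) * ln 2)"
        using n bounds[of n] ln_lo[of n] nonneg mono by (intro frac_le) (auto simp: mono_def)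
      also have "\<dots> = L (Suc (K n)) * (real ((Suc (K n))\<^sup>2) / real ((K n)\<^sup>2)) / ln 2"
        by (simp add: L_def del: of_nat_power of_nat_Suc)
      finally show "a n / ln (real n) \<le> L (Suc (K n)) * (real ((Suc (K n))\<^sup>2) / real ((K n)\<^sup>2)) / ln 2" .
    qed
    show "(\<lambda>n. L (K n) * (real ((K n)\<^sup>2) / real ((Suc (K n))\<^sup>2)) / ln 2) \<longlonglongrightarrow> c / ln 2"
      using filterlim_compose[OF lo K] by simp
    show "(\<lambda>n. L (Suc (K n)) * (real ((Suc (K n))\<^sup>2) / real ((K n)\<^sup>2)) / ln 2) \<longlonglongrightarrow> c / ln 2"
      using filterlim_compose[OF hi K] by simp
  qed
qed

lemma AE_successes_over_ln: "AE \<omega> in coin_space. (\<lambda>n. real (successes n \<omega>) / ln (real n)) \<longlonglongrightarrow> 1"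
proof -
  \<comment> \<open>The summand 1 keeps the divisor nonzero at \<open>k = 0\<close> and fits the
    estimate \<open>2 ^ k\<^sup>2 + 1 \<le> 2 ^ (k\<^sup>2 + 1)\<close> below. As the variance is at
    most \<open>?d k\<close>, dividing by \<open>(?d k)\<^sup>2\<close> leaves the summable bound
    \<open>1 / ?d k\<close>.\<close>
  let ?d = "\<lambda>k::nat. real k ^ 2 + 1"
  let ?Y = "\<lambda>k \<omega>. (real (successes (2 ^ k\<^sup>2) \<omega>) - mean_successes (2 ^ k\<^sup>2)) / ?d k"
  have mean_le: "mean_successes (2 ^ k\<^sup>2) \<le> ?d k" for k
  proof -
    have "mean_successes (2 ^ k\<^sup>2) \<le> ln (real (2 ^ k\<^sup>2) + 1)" by (rule mean_successes_le_ln)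
    also have "\<dots> \<le> ln (2 ^ Suc (k\<^sup>2))" by (subst ln_le_cancel_iff) (auto intro: add_pos_pos)
    also have "\<dots> = ?d k * ln 2" by (subst ln_realpow) auto
    also have "\<dots> \<le> ?d k * 1" using ln_2_less_1 by (intro mult_left_mono) auto
    finally show ?thesis by simp
  qed
  have "AE \<omega> in coin_space. (\<lambda>k. ?Y k \<omega>) \<longlonglongrightarrow> 0"
  proof (rule AE_tendsto_zero_if_second_moments_summable[where b="\<lambda>k. 1 / ?d k"])
    show "integrable coin_space (\<lambda>\<omega>. (?Y k \<omega>)\<^sup>2)" for k
      by (rule integrable_successes[of "\<lambda>j. ((real j - _) / ?d k)\<^sup>2"])
    show "(\<integral>\<omega>. (?Y k \<omega>)\<^sup>2 \<partial>coin_space) \<le> 1 / ?d k" for k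
    proof -
      have d: "?d k > 0" by (simp add: add_nonneg_pos)
      have "(\<integral>\<omega>. (?Y k \<omega>)\<^sup>2 \<partial>coin_space) =
          (\<integral>\<omega>. (real (successes (2 ^ k\<^sup>2) \<omega>) - mean_successes (2 ^ k\<^sup>2))\<^sup>2 \<partial>coin_space) / (?d k)\<^sup>2"
        by (simp add: power_divide)
      also have "\<dots> \<le> ?d k / (?d k)\<^sup>2"
        using variance_successes_le[of "2 ^ k\<^sup>2"] mean_le[of k] by (intro divide_right_mono) auto
      also have "\<dots> = 1 / ?d k" using d by (simp add: power2_eq_square)
      finally show ?thesis .
    qed
    show "summable (\<lambda>k. 1 / ?d k)"
    proof (rule summable_comparison_test_bigo[where g="\<lambda>k. 1 / real k ^ 2"])
      show "summable (\<lambda>k. norm (1 / real k ^ 2))"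
        using inverse_power_summable[of 2, where ?'a=real] by (simp add: field_simps)
      show "(\<lambda>k. 1 / ?d k) \<in> O(\<lambda>k. 1 / real k ^ 2)" by real_asymp
    qed
  qed
  then show ?thesis
  proof eventually_elim
    fix \<omega> assume Y: "(\<lambda>k. ?Y k \<omega>) \<longlonglongrightarrow> 0"
    have "filterlim (\<lambda>k::nat. 2 ^ k\<^sup>2 :: nat) at_top sequentially"
    proof (rule filterlim_at_top_mono[OF filterlim_ident])
      have "k \<le> 2 ^ k\<^sup>2" for k :: nat
        by (metis less_exp less_imp_le le_trans power2_nat_le_imp_le[of k] power2_eq_square le_square)
      then show "\<forall>\<^sub>F k in sequentially. k \<le> (2::nat) ^ k\<^sup>2" by simp
    qed
    from filterlim_compose[OF mean_successes_asymp this]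
    have m: "(\<lambda>k. mean_successes (2 ^ k\<^sup>2) / ln (real (2 ^ k\<^sup>2))) \<longlonglongrightarrow> 1" .
    \<comment> \<open>The first term changes the divisor from \<open>?d k\<close> to
      \<open>k\<^sup>2\<close>; in the second, \<open>ln 2\<close> cancels against
      \<open>ln (2 ^ k\<^sup>2) = k\<^sup>2 * ln 2\<close>. The limit \<open>ln 2\<close> becomes 1
      in \<open>tendsto_over_ln_of_subsequence\<close>.\<close>
    have "(\<lambda>k. ?Y k \<omega> * (?d k / real (k\<^sup>2)) + mean_successes (2 ^ k\<^sup>2) / ln (real (2 ^ k\<^sup>2)) * ln 2) \<longlonglongrightarrow> 0 * 1 + 1 * ln 2"
      by (intro tendsto_add tendsto_mult Y m tendsto_const) (simp, real_asymp)
    moreover have "\<forall>\<^sub>F k in sequentially. ?Y k \<omega> * (?d k / real (k\<^sup>2)) +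
        mean_successes (2 ^ k\<^sup>2) / ln (real (2 ^ k\<^sup>2)) * ln 2 = real (successes (2 ^ k\<^sup>2) \<omega>) / real (k\<^sup>2)"
      using eventually_gt_at_top[of 0]
    proof eventually_elim
      fix k :: nat assume k: "0 < k"
      have "?d k \<noteq> 0" by (metis add_nonneg_pos less_irrefl zero_le_power2 zero_less_one)
      with k show "?Y k \<omega> * (?d k / real (k\<^sup>2)) +
        mean_successes (2 ^ k\<^sup>2) / ln (real (2 ^ k\<^sup>2)) * ln 2 = real (successes (2 ^ k\<^sup>2) \<omega>) / real (k\<^sup>2)"
        by (simp add: ln_realpow) (simp add: diff_divide_distrib)
    qed
    ultimately have "(\<lambda>k. real (successes (2 ^ k\<^sup>2) \<omega>) / real (k\<^sup>2)) \<longlonglongrightarrow> ln 2"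
      by (simp add: tendsto_cong)
    from tendsto_over_ln_of_subsequence[OF _ _ this]
    show "(\<lambda>n. real (successes n \<omega>) / ln (real n)) \<longlonglongrightarrow> 1"
      using mono_successes[of \<omega>] by (simp add: mono_def)
  qed
qed

section \<open>Asymptotic normality\<close>

text \<open>Each factor is the characteristic function of one coin, contributed by one application
  of the recursion. The form \<open>1 + p * (iexp s - 1)\<close> prepares the comparison with
  \<open>exp (p * (iexp s - 1))\<close>.\<close>

lemma expectation_iexp_successes:
  "(\<integral>\<omega>. iexp (s * real (successes n \<omega>)) \<partial>coin_space) =
    (\<Prod>i<n. 1 + complex_of_real (1 / (real i + 2)) * (iexp s - 1))"
proof (induction n)
  case 0
  show ?case by (simp add: coin_space.prob_space)
next
  case (Suc n)
  let ?p = "1 / (real n + 2)"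
  let ?E = "\<integral>\<omega>. iexp (s * real (successes n \<omega>)) \<partial>coin_space"
  have shift: "(\<integral>\<omega>. iexp (s * real (Suc (successes n \<omega>))) \<partial>coin_space) = iexp s * ?E"
    using integrable_successes[of "\<lambda>k. iexp (s * real k)" n]
    by (subst integral_mult_right_zero[symmetric]) (simp add: exp_add[symmetric] algebra_simps)
  have "(\<integral>\<omega>. iexp (s * real (successes (Suc n) \<omega>)) \<partial>coin_space) = (1 - ?p) *\<^sub>R ?E + ?p *\<^sub>R (iexp s * ?E)"
    using expectation_successes_Suc[of "\<lambda>k. iexp (s * real k)" n] shift by simp
  also have "\<dots> = ?E * (1 + complex_of_real ?p * (iexp s - 1))"
    by (simp only: scaleR_conv_of_real of_real_diff of_real_1) (simp only: algebra_simps mult_1_left)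
  finally show ?case unfolding Suc.IH by (simp only: prod.lessThan_Suc)
qed

text \<open>Comparison with the telescoping sum of \<open>1 / ((i + 1) * (i + 2))\<close>. The bound
  is uniform in \<open>n\<close>, so the total Poisson error is controlled by \<open>s\<close>
  alone.\<close>

lemma sum_inverse_squares_le: "(\<Sum>i<n. (1 / (real i + 2))\<^sup>2) \<le> 1"
proof -
  have "(\<Sum>i<n. (1 / (real i + 2))\<^sup>2) \<le> (\<Sum>i<n. 1 / (real i + 1) - 1 / (real (Suc i) + 1))"
  proof (rule sum_mono)
    fix i
    have "(1 / (real i + 2))\<^sup>2 \<le> 1 / ((real i + 1) * (real i + 2))"
      by (simp add: power2_eq_square frac_le)
    also have "\<dots> = 1 / (real i + 1) - 1 / (real (Suc i) + 1)" by (simp add: field_simps)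
    finally show "(1 / (real i + 2))\<^sup>2 \<le> 1 / (real i + 1) - 1 / (real (Suc i) + 1)" .
  qed
  also have "\<dots> = 1 - 1 / (real n + 1)"
    by (subst sum_lessThan_telescope') simp
  finally show ?thesis by (rule order_trans) simp
qed

text \<open>Taylor expansion to first order; 3 is an upper bound for \<open>exp 1\<close>, which
  dominates \<open>exp \<bar>Re w\<bar>\<close> on the unit disc.\<close>

lemma norm_exp_minus_linear_le:
  fixes w :: complex
  assumes "norm w \<le> 1"
  shows "norm (1 + w - exp w) \<le> 3 * (norm w)\<^sup>2"
proof -
  have "norm (exp w - (\<Sum>k\<le>1. w ^ k / fact k)) \<le> exp \<bar>Re w\<bar> * norm w ^ Suc 1 / fact 1"
    by (rule Taylor_exp)
  also have "\<dots> \<le> 3 * (norm w)\<^sup>2"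
  proof -
    have "exp \<bar>Re w\<bar> \<le> exp 1" using abs_Re_le_cmod[of w] assms by simp
    then have "exp \<bar>Re w\<bar> \<le> 3" using exp_le by linarith
    then show ?thesis by (simp add: power2_eq_square mult_right_mono)
  qed
  finally show ?thesis by (simp add: norm_minus_commute)
qed

lemma norm_iexp_minus_1_le: "norm (iexp s - 1) \<le> \<bar>s\<bar>"
  using iexp_approx1[of s 0] by simp

text \<open>Poisson approximation: \<open>exp (m * (iexp s - 1))\<close> is the characteristic function of the Poisson law of mean \<open>m\<close>.\<close>

lemma iexp_successes_poisson:
  "norm ((\<integral>\<omega>. iexp (s * real (successes n \<omega>)) \<partial>coin_space) -
      exp (complex_of_real (mean_successes n) * (iexp s - 1))) \<le> 3 * s\<^sup>2"
proof -
  define z where "z = iexp s - 1"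
  let ?w = "\<lambda>i::nat. complex_of_real (1 / (real i + 2)) * z"
  have z: "norm z \<le> \<bar>s\<bar>" "norm z \<le> 2"
    using norm_iexp_minus_1_le[of s] norm_triangle_ineq4[of "iexp s" 1] by (auto simp: z_def)
  have Re: "Re z \<le> 0" using complex_Re_le_cmod[of "iexp s"] by (simp add: z_def)
  \<comment> \<open>The second bound, from a success probability of at most 1/2 and
    \<open>norm z \<le> 2\<close>, admits \<open>norm_exp_minus_linear_le\<close>. The first retains
    the factor \<open>\<bar>s\<bar>\<close> that makes the final error quadratic in
    \<open>s\<close>.\<close>
  have w: "norm (?w i) \<le> 1 / (real i + 2) * \<bar>s\<bar>" "norm (?w i) \<le> 1" for i
  proof -
    have n: "norm (?w i) = 1 / (real i + 2) * norm z" by (simp only: norm_mult norm_of_real) simp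
    show "norm (?w i) \<le> 1 / (real i + 2) * \<bar>s\<bar>" unfolding n using z by (intro mult_left_mono) auto
    have "norm (?w i) \<le> 1 / (real i + 2) * 2" unfolding n using z by (intro mult_left_mono) auto
    also have "\<dots> \<le> 1" by simp
    finally show "norm (?w i) \<le> 1" .
  qed
  have "exp (complex_of_real (mean_successes n) * z) = (\<Prod>i<n. exp (?w i))"
    by (simp add: mean_successes_def sum_distrib_right exp_sum)
  \<comment> \<open>Products of numbers in the closed unit disc differ by at most the sum of the
    differences of their factors. Here \<open>1 + ?w i\<close> is a convex combination of 1 and
    \<open>iexp s\<close>, and the exponent of \<open>exp (?w i)\<close> has nonpositive real
    part.\<close>
  moreover have "norm ((\<Prod>i<n. 1 + ?w i) - (\<Prod>i<n. exp (?w i))) \<le> (\<Sum>i<n. norm (1 + ?w i - exp (?w i)))"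
  proof (rule norm_prod_diff)
    fix i
    have "1 + ?w i = complex_of_real (1 - 1 / (real i + 2)) + complex_of_real (1 / (real i + 2)) * iexp s"
      by (simp add: z_def diff_divide_distrib)
    also have "norm \<dots> \<le> \<bar>1 - 1 / (real i + 2)\<bar> + 1 / (real i + 2)"
      by (rule order_trans[OF norm_triangle_ineq]) (simp only: norm_mult norm_of_real norm_exp_i_times, simp)
    also have "\<dots> = 1" by (simp add: field_simps)
    finally show "norm (1 + ?w i) \<le> 1" .
    have "Re (?w i) \<le> 0" using Re by (simp add: divide_nonpos_nonneg)
    then show "norm (exp (?w i)) \<le> 1" by (simp add: norm_exp_eq_Re)
  qed
  moreover have "(\<Sum>i<n. norm (1 + ?w i - exp (?w i))) \<le> (\<Sum>i<n. 3 * s\<^sup>2 * (1 / (real i + 2))\<^sup>2)"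
  proof (rule sum_mono)
    fix i
    have "norm (1 + ?w i - exp (?w i)) \<le> 3 * (norm (?w i))\<^sup>2" by (rule norm_exp_minus_linear_le[OF w(2)])
    also have "\<dots> \<le> 3 * (1 / (real i + 2) * \<bar>s\<bar>)\<^sup>2"
      using w(1)[of i] by (intro mult_left_mono power_mono) auto
    finally show "norm (1 + ?w i - exp (?w i)) \<le> 3 * s\<^sup>2 * (1 / (real i + 2))\<^sup>2"
      by (simp add: power_mult_distrib power_divide)
  qed
  moreover have "(\<Sum>i<n. 3 * s\<^sup>2 * (1 / (real i + 2))\<^sup>2) \<le> 3 * s\<^sup>2 * 1"
    unfolding sum_distrib_left[symmetric] by (intro mult_left_mono sum_inverse_squares_le) auto
  ultimately show ?thesis
    unfolding expectation_iexp_successes z_def by simp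
qed

text \<open>With \<open>s = t / sqrt (ln n)\<close>, the Poisson exponent
  \<open>m * (iexp s - 1)\<close> minus \<open>\<i> * s * ln n\<close> equals
  \<open>\<i> * s * (m - ln n) - m * s\<^sup>2 / 2 + m * e s\<close>. The first term tends to 0, the
  second to \<open>- t\<^sup>2 / 2\<close>, and the last to 0, being of order
  \<open>m * \<bar>s\<bar> ^ 3\<close>.\<close>

lemma char_successes_normalized_tendsto:
  "(\<lambda>n. char (distr coin_space borel (\<lambda>\<omega>. (real (successes n \<omega>) - ln (real n)) / sqrt (ln (real n)))) t)
    \<longlonglongrightarrow> exp (- complex_of_real (t\<^sup>2 / 2))"
proof -
  define s where "s n = t / sqrt (ln (real n))" for n
  define m where "m = mean_successes"
  \<comment> \<open>\<open>e\<close> is the Taylor remainder of \<open>iexp\<close> after the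
    quadratic term; \<open>D\<close> is the error of the Poisson approximation.\<close>
  define e where "e x = iexp x - 1 - \<i> * complex_of_real x + complex_of_real (x\<^sup>2 / 2)" for x
  define D where "D n = (\<integral>\<omega>. iexp (s n * real (successes n \<omega>)) \<partial>coin_space) -
      exp (complex_of_real (m n) * (iexp (s n) - 1))" for n
  have s0: "s \<longlonglongrightarrow> 0"
  proof -
    have "filterlim (\<lambda>n. sqrt (ln (real n))) at_top sequentially" by real_asymp
    then show ?thesis unfolding s_def[abs_def] by (intro real_tendsto_divide_at_top[OF tendsto_const])
  qed
  have D0: "D \<longlonglongrightarrow> 0"
  proof (rule Lim_null_comparison)
    show "\<forall>\<^sub>F n in sequentially. norm (D n) \<le> 3 * (s n)\<^sup>2"
      unfolding D_def m_def using iexp_successes_poisson by simp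
    show "(\<lambda>n. 3 * (s n)\<^sup>2) \<longlonglongrightarrow> 0" using s0 by (auto intro!: tendsto_eq_intros)
  qed
  have ms: "(\<lambda>n. m n * (s n)\<^sup>2) \<longlonglongrightarrow> t\<^sup>2"
  proof -
    have "(\<lambda>n. m n / ln (real n) * t\<^sup>2) \<longlonglongrightarrow> 1 * t\<^sup>2"
      unfolding m_def by (intro tendsto_intros mean_successes_asymp)
    moreover have "\<forall>\<^sub>F n in sequentially. m n / ln (real n) * t\<^sup>2 = m n * (s n)\<^sup>2"
      using eventually_gt_at_top[of 1] by eventually_elim (simp add: s_def power_divide)
    ultimately show ?thesis by (simp add: tendsto_cong)
  qed
  have e_le: "norm (e x) \<le> \<bar>x\<bar> ^ 3" for x
  proof -
    have "e x = iexp x - (\<Sum>k\<le>2. (\<i> * x) ^ k / fact k)"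
      by (simp add: e_def numeral_2_eq_2 power_mult_distrib)
    also have "norm \<dots> \<le> \<bar>x\<bar> ^ Suc 2 / fact (Suc 2)" by (rule iexp_approx1)
    also have "\<dots> \<le> \<bar>x\<bar> ^ 3 / 1" by (intro frac_le) (auto simp: eval_nat_numeral)
    finally show ?thesis by simp
  qed
  have me: "(\<lambda>n. complex_of_real (m n) * e (s n)) \<longlonglongrightarrow> 0"
  proof (rule Lim_null_comparison)
    have "norm (complex_of_real (m n) * e (s n)) \<le> m n * (s n)\<^sup>2 * \<bar>s n\<bar>" for n
    proof -
      have "0 \<le> m n" by (simp add: m_def mean_successes_def sum_nonneg)
      then have "norm (complex_of_real (m n) * e (s n)) \<le> m n * \<bar>s n\<bar> ^ 3"
        using e_le[of "s n"] by (simp add: norm_mult mult_left_mono)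
      also have "\<bar>s n\<bar> ^ 3 = (s n)\<^sup>2 * \<bar>s n\<bar>" by (simp add: power2_eq_square power3_eq_cube abs_mult)
      finally show ?thesis by (simp add: mult.assoc)
    qed
    then show "\<forall>\<^sub>F n in sequentially. norm (complex_of_real (m n) * e (s n)) \<le> m n * (s n)\<^sup>2 * \<bar>s n\<bar>" by simp
    show "(\<lambda>n. m n * (s n)\<^sup>2 * \<bar>s n\<bar>) \<longlonglongrightarrow> 0"
      using tendsto_mult[OF ms tendsto_rabs[OF s0]] by simp
  qed
  have drift: "(\<lambda>n. s n * (m n - ln (real n))) \<longlonglongrightarrow> 0"
  proof -
    obtain c where "(\<lambda>n. m n - ln (real n)) \<longlonglongrightarrow> c"
      using mean_successes_minus_ln by (auto simp: convergent_def m_def)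
    from tendsto_mult[OF s0 this] show ?thesis by simp
  qed
  have char_eq: "char (distr coin_space borel (\<lambda>\<omega>. (real (successes n \<omega>) - ln (real n)) / sqrt (ln (real n)))) t =
      iexp (- (s n * ln (real n))) * D n +
      exp (\<i> * complex_of_real (s n * (m n - ln (real n))) - complex_of_real (m n * (s n)\<^sup>2) / 2 + complex_of_real (m n) * e (s n))"
    for n
  proof -
    have "char (distr coin_space borel (\<lambda>\<omega>. (real (successes n \<omega>) - ln (real n)) / sqrt (ln (real n)))) t =
        (\<integral>\<omega>. iexp (t * ((real (successes n \<omega>) - ln (real n)) / sqrt (ln (real n)))) \<partial>coin_space)"
      unfolding char_def by (rule integral_distr) measurable
    also have "\<dots> = (\<integral>\<omega>. iexp (- (s n * ln (real n))) * iexp (s n * real (successes n \<omega>)) \<partial>coin_space)"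
      by (intro Bochner_Integration.integral_cong refl)
         (simp add: s_def exp_add[symmetric] diff_divide_distrib algebra_simps)
    also have "\<dots> = iexp (- (s n * ln (real n))) * (D n + exp (complex_of_real (m n) * (iexp (s n) - 1)))"
      by (simp add: D_def)
    also have "\<dots> = iexp (- (s n * ln (real n))) * D n +
        exp (\<i> * complex_of_real (- (s n * ln (real n))) + complex_of_real (m n) * (iexp (s n) - 1))"
      by (simp only: distrib_left exp_add)
    also have "iexp (s n) - 1 = \<i> * complex_of_real (s n) - complex_of_real ((s n)\<^sup>2 / 2) + e (s n)"
      by (simp add: e_def)
    finally show ?thesis by (simp add: algebra_simps)
  qed
  \<comment> \<open>The prefactor comes from the centering and has modulus 1, so the Poisson error
    still vanishes.\<close>
  have "(\<lambda>n. iexp (- (s n * ln (real n))) * D n) \<longlonglongrightarrow> 0"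
    by (rule Lim_null_comparison[OF _ tendsto_norm_zero[OF D0]]) (simp add: norm_mult)
  moreover have "(\<lambda>n. exp (\<i> * complex_of_real (s n * (m n - ln (real n))) - complex_of_real (m n * (s n)\<^sup>2) / 2 + complex_of_real (m n) * e (s n)))
      \<longlonglongrightarrow> exp (\<i> * complex_of_real 0 - complex_of_real (t\<^sup>2) / 2 + 0)"
    by (intro tendsto_intros drift ms me) simp
  ultimately have "(\<lambda>n. iexp (- (s n * ln (real n))) * D n +
      exp (\<i> * complex_of_real (s n * (m n - ln (real n))) - complex_of_real (m n * (s n)\<^sup>2) / 2 + complex_of_real (m n) * e (s n)))
      \<longlonglongrightarrow> 0 + exp (\<i> * complex_of_real 0 - complex_of_real (t\<^sup>2) / 2 + 0)"
    by (rule tendsto_add)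
  then show ?thesis unfolding char_eq by simp
qed

lemma weak_conv_successes_normalized:
  "weak_conv_m (\<lambda>n. distr coin_space borel (\<lambda>\<omega>. (real (successes n \<omega>) - ln (real n)) / sqrt (ln (real n))))
    std_normal_distribution"
proof (rule levy_continuity)
  show "real_distribution (distr coin_space borel (\<lambda>\<omega>. (real (successes n \<omega>) - ln (real n)) / sqrt (ln (real n))))" for n
    by (rule coin_space.real_distribution_distr) measurable
  show "real_distribution std_normal_distribution" by (rule real_dist_normal_dist)
  show "(\<lambda>n. char (distr coin_space borel (\<lambda>\<omega>. (real (successes n \<omega>) - ln (real n)) / sqrt (ln (real n)))) t)
      \<longlonglongrightarrow> char std_normal_distribution t" for t
    using char_successes_normalized_tendsto[of t]
    by (simp add: char_std_normal_distribution exp_of_real[symmetric])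
qed

section \<open>Generated filtrations and product extensions\<close>

lemma space_gen_sigma [simp]: "space (gen_sigma M S I X) = space M"
  unfolding gen_sigma_def by (rule space_measure_of) auto

lemma sets_gen_sigma:
  "sets (gen_sigma M S I X) = sigma_sets (space M) {X i -` A \<inter> space M | i A. i \<in> I \<and> A \<in> sets S}"
  unfolding gen_sigma_def by (rule sets_measure_of) auto

lemma sets_gen_sigma_subset:
  assumes "space G = space M" and "\<And>i. i \<in> I \<Longrightarrow> X i \<in> measurable G S"
  shows "sets (gen_sigma M S I X) \<subseteq> sets G"
proof -
  have "{X i -` A \<inter> space M | i A. i \<in> I \<and> A \<in> sets S} \<subseteq> sets G"
    using measurable_sets[OF assms(2)] assms(1) by auto
  then show ?thesis
    unfolding sets_gen_sigma assms(1)[symmetric] by (rule sets.sigma_sets_subset)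
qed

lemma measurable_gen_sigma:
  assumes "i \<in> I" and "X i \<in> space M \<rightarrow> space S"
  shows "X i \<in> measurable (gen_sigma M S I X) S"
  using assms by (intro measurableI) (auto simp: sets_gen_sigma)

lemma space_enlarged_filtration [simp]: "space (enlarged_filtration N S X \<tau> k) = space N"
  unfolding enlarged_filtration_def
  using sets.sets_into_space[of _ "gen_sigma N S {..k} X"]
    sets.sets_into_space[of _ "gen_sigma N (count_space UNIV) UNIV \<tau>"]
  by (intro space_measure_of) (auto simp del: sets_measure_of)

lemma sets_enlarged_filtration:
  "sets (enlarged_filtration N S X \<tau> k) =
    sigma_sets (space N) (sets (gen_sigma N S {..k} X) \<union> sets (gen_sigma N (count_space UNIV) UNIV \<tau>))"
  unfolding enlarged_filtration_def
  using sets.sets_into_space[of _ "gen_sigma N S {..k} X"]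
    sets.sets_into_space[of _ "gen_sigma N (count_space UNIV) UNIV \<tau>"]
  by (intro sets_measure_of) (auto simp del: sets_measure_of)

lemma sets_enlarged_filtration_subset:
  assumes "space G = space N" and "\<And>i. i \<le> k \<Longrightarrow> X i \<in> measurable G S"
    and "\<And>n. \<tau> n \<in> measurable G (count_space UNIV)"
  shows "sets (enlarged_filtration N S X \<tau> k) \<subseteq> sets G"
proof -
  have "sets (gen_sigma N S {..k} X) \<union> sets (gen_sigma N (count_space UNIV) UNIV \<tau>) \<subseteq> sets G"
    using assms sets_gen_sigma_subset[of G N "{..k}" X S]
      sets_gen_sigma_subset[of G N UNIV \<tau> "count_space UNIV"] by auto
  then show ?thesis
    unfolding sets_enlarged_filtration assms(1)[symmetric] by (rule sets.sigma_sets_subset)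
qed

lemma measurable_enlarged_filtration:
  shows "X \<in> UNIV \<rightarrow> space N \<rightarrow> space S \<Longrightarrow> i \<le> k \<Longrightarrow> X i \<in> measurable (enlarged_filtration N S X \<tau> k) S"
    and "\<tau> n \<in> measurable (enlarged_filtration N S X \<tau> k) (count_space UNIV)"
proof -
  have sub: "sets (gen_sigma N S {..k} X) \<subseteq> sets (enlarged_filtration N S X \<tau> k)"
    "sets (gen_sigma N (count_space UNIV) UNIV \<tau>) \<subseteq> sets (enlarged_filtration N S X \<tau> k)"
    unfolding sets_enlarged_filtration by auto
  show "X i \<in> measurable (enlarged_filtration N S X \<tau> k) S" if "X \<in> UNIV \<rightarrow> space N \<rightarrow> space S" "i \<le> k"
    using that sub(1) by (intro measurable_mono[THEN subsetD, OF _ _ _ _ measurable_gen_sigma[of i "{..k}" X N S]]) auto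
  show "\<tau> n \<in> measurable (enlarged_filtration N S X \<tau> k) (count_space UNIV)"
    using sub(2) by (intro measurable_mono[THEN subsetD, OF _ _ _ _ measurable_gen_sigma[of n UNIV \<tau> N "count_space UNIV"]]) auto
qed

lemma filtration_enlarged_filtration:
  assumes "X \<in> UNIV \<rightarrow> space N \<rightarrow> space S"
  shows "filtration (space N) (enlarged_filtration N S X \<tau>)"
proof
  show "sets (enlarged_filtration N S X \<tau> i) \<subseteq> sets (enlarged_filtration N S X \<tau> j)" if "i \<le> j" for i j
    using that assms
    by (intro sets_enlarged_filtration_subset) (auto intro: measurable_enlarged_filtration)
qed simp

text \<open>The enlarged filtration contains the whole sequence \<open>\<tau>\<close> already at
  time 0, so each \<open>\<tau> n\<close> is measurable at every time.\<close>

lemma stopping_time_enlarged_filtration: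
  "stopping_time (enlarged_filtration N S X \<tau>) (\<tau> n)"
  unfolding stopping_time_def
proof
  fix t
  have [measurable]: "\<tau> n \<in> measurable (enlarged_filtration N S X \<tau> t) (count_space UNIV)"
    by (rule measurable_enlarged_filtration)
  show "Measurable.pred (enlarged_filtration N S X \<tau> t) (\<lambda>\<omega>. \<tau> n \<omega> \<le> t)" by measurable
qed

text \<open>Sets generated by the first coordinate have the form \<open>A \<times> space T\<close>,
  those generated by the second \<open>space N \<times> B\<close>, and the product measure
  factorizes on the intersection \<open>A \<times> B\<close>.\<close>

lemma indep_sequences_pair:
  assumes "prob_space N" "prob_space T"
    and X: "\<And>n. X n \<in> measurable N S" and Y: "\<And>n. Y n \<in> measurable T K"
  shows "indep_sequences (N \<Otimes>\<^sub>M T) S (\<lambda>n. X n \<circ> fst) K (\<lambda>n. Y n \<circ> snd)"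
proof -
  interpret N: prob_space N by fact
  interpret T: prob_space T by fact
  interpret P: pair_prob_space N T ..
  \<comment> \<open>Each generated \<sigma>-algebra is placed inside the pullback of a factor, whose
    members are exactly the preimages of measurable sets.\<close>
  have 1: "sets (gen_sigma (N \<Otimes>\<^sub>M T) S UNIV (\<lambda>n. X n \<circ> fst)) \<subseteq> sets (vimage_algebra (space (N \<Otimes>\<^sub>M T)) fst N)"
    by (rule sets_gen_sigma_subset)
       (auto intro!: measurable_comp[OF measurable_vimage_algebra1 X] simp: space_pair_measure)
  have 2: "sets (gen_sigma (N \<Otimes>\<^sub>M T) K UNIV (\<lambda>n. Y n \<circ> snd)) \<subseteq> sets (vimage_algebra (space (N \<Otimes>\<^sub>M T)) snd T)"
    by (rule sets_gen_sigma_subset)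
       (auto intro!: measurable_comp[OF measurable_vimage_algebra1 Y] simp: space_pair_measure)
  show ?thesis unfolding indep_sequences_def
  proof (rule P.indep_setI)
    fix a b
    assume "a \<in> sets (gen_sigma (N \<Otimes>\<^sub>M T) S UNIV (\<lambda>n. X n \<circ> fst))"
      "b \<in> sets (gen_sigma (N \<Otimes>\<^sub>M T) K UNIV (\<lambda>n. Y n \<circ> snd))"
    then have ab: "a \<in> sets (vimage_algebra (space (N \<Otimes>\<^sub>M T)) fst N)"
      "b \<in> sets (vimage_algebra (space (N \<Otimes>\<^sub>M T)) snd T)"
      using 1 2 by auto
    have "fst \<in> space (N \<Otimes>\<^sub>M T) \<rightarrow> space N" "snd \<in> space (N \<Otimes>\<^sub>M T) \<rightarrow> space T"
      by (auto simp: space_pair_measure)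
    from ab[unfolded sets_vimage_algebra2[OF this(1)] sets_vimage_algebra2[OF this(2)]]
    obtain A B where A: "A \<in> sets N" "a = fst -` A \<inter> space (N \<Otimes>\<^sub>M T)"
      and B: "B \<in> sets T" "b = snd -` B \<inter> space (N \<Otimes>\<^sub>M T)"
      by blast
    have eq: "a = A \<times> space T" "b = space N \<times> B" "a \<inter> b = A \<times> B"
      using A B sets.sets_into_space[OF A(1)] sets.sets_into_space[OF B(1)]
      by (auto simp: space_pair_measure)
    show "P.prob (a \<inter> b) = P.prob a * P.prob b"
      unfolding eq(3) unfolding eq(1,2) using A(1) B(1)
      by (simp add: measure_def T.emeasure_pair_measure_Times enn2real_mult N.emeasure_space_1 T.emeasure_space_1)
  qed (rule sets_gen_sigma_subset; use X Y in measurable)+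
qed

section \<open>The Markov property under adjoined independent randomness\<close>

lemma measurable_kernel_measure:
  assumes "R \<in> measurable S (prob_algebra S)" "A \<in> sets S"
  shows "(\<lambda>s. measure (R s) A) \<in> borel_measurable S"
  using measurable_prob_algebraD[OF assms(1)] assms(2) by measurable

lemma kernel_measure_le_1:
  assumes "R \<in> measurable S (prob_algebra S)" "s \<in> space S"
  shows "measure (R s) A \<le> 1"
proof -
  have "prob_space (R s)" using assms by (auto simp: space_prob_algebra dest: measurable_space)
  then show ?thesis by (rule prob_space.prob_le_1)
qed

text \<open>For each fixed \<open>t\<close>, a set \<open>C\<close> in \<open>H k\<close> has its
  section at \<open>t\<close> in \<open>F k\<close>. The Markov property of \<open>X\<close> applies
  on that section, and integrating over \<open>t\<close> gives the identity that characterizes the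
  conditional expectation on \<open>C\<close>.\<close>

lemma markov_chain_wrt_pair:
  fixes N :: "'b measure" and T :: "'t measure" and S :: "'s measure"
  assumes R: "R \<in> measurable S (prob_algebra S)"
    and T: "prob_space T"
    and chain: "markov_chain_wrt N F S R \<mu> X"
    and H: "filtration (space (N \<Otimes>\<^sub>M T)) H"
    and HF: "\<And>k. sets (H k) \<subseteq> sets (F k \<Otimes>\<^sub>M T)"
    and XH: "\<And>k. X k \<circ> fst \<in> measurable (H k) S"
  shows "markov_chain_wrt (N \<Otimes>\<^sub>M T) H S R \<mu> (\<lambda>n. X n \<circ> fst)"
proof -
  interpret N: prob_space N using chain by (simp add: markov_chain_wrt_def)
  interpret T: prob_space T by fact
  interpret P: pair_prob_space N T ..
  have sub: "subalgebra N (F k)" and XF: "X k \<in> measurable (F k) S" for k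
    using chain by (auto simp: markov_chain_wrt_def)
  have [measurable]: "X k \<in> measurable N S" for k
    by (rule measurable_from_subalg[OF sub XF])
  have FT: "sets (F k \<Otimes>\<^sub>M T) \<subseteq> sets (N \<Otimes>\<^sub>M T)" for k
  proof -
    \<comment> \<open>Measurability of \<open>id\<close> from \<open>N\<close> to the coarser
      \<open>F k\<close> passes to products, where preimages under the resulting identity map give
      the inclusion.\<close>
    have "id \<in> measurable N (F k)"
      using sub[of k] by (auto simp: subalgebra_def measurable_def sets.sets_into_space Int_absorb2)
    then have "(\<lambda>\<omega>. (id (fst \<omega>), snd \<omega>)) \<in> measurable (N \<Otimes>\<^sub>M T) (F k \<Otimes>\<^sub>M T)" by measurable
    moreover have "space (F k \<Otimes>\<^sub>M T) = space (N \<Otimes>\<^sub>M T)"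
      using sub[of k] by (simp add: space_pair_measure subalgebra_def)
    ultimately show ?thesis
      using measurable_sets[of _ "N \<Otimes>\<^sub>M T" "F k \<Otimes>\<^sub>M T"] sets.sets_into_space[of _ "F k \<Otimes>\<^sub>M T"]
      by (fastforce simp: Int_absorb2)
  qed
  have subH: "subalgebra (N \<Otimes>\<^sub>M T) (H k)" for k
    using HF[of k] FT[of k] filtration.space_F[OF H] by (auto simp: subalgebra_def)
  have cond: "AE \<omega> in N \<Otimes>\<^sub>M T. real_cond_exp (N \<Otimes>\<^sub>M T) (H k)
        (\<lambda>\<omega>. indicator A ((X (Suc k) \<circ> fst) \<omega>)) \<omega> = measure (R ((X k \<circ> fst) \<omega>)) A"
    if A[measurable]: "A \<in> sets S" for k A
  proof -
    interpret F: finite_measure_subalgebra N "F k" using sub by unfold_locales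
    interpret HH: finite_measure_subalgebra "N \<Otimes>\<^sub>M T" "H k" using subH by unfold_locales
    have Rm[measurable]: "(\<lambda>s. measure (R s) A) \<in> borel_measurable S"
      by (rule measurable_kernel_measure[OF R A])
    have RX: "measure (R (X k x)) A \<le> 1" if "x \<in> space N" for x
      using that measurable_space[OF \<open>X k \<in> measurable N S\<close>] by (intro kernel_measure_le_1[OF R]) auto
    have intN: "integrable N (\<lambda>x. indicator A (X (Suc k) x) :: real)"
      by (rule N.integrable_const_bound[where B=1]) auto
    have ae: "AE x in N. real_cond_exp N (F k) (\<lambda>x. indicator A (X (Suc k) x)) x = measure (R (X k x)) A"
      using chain A by (auto simp: markov_chain_wrt_def)
    have slice: "(\<integral>x\<in>B. indicator A (X (Suc k) x) \<partial>N) = (\<integral>x\<in>B. measure (R (X k x)) A \<partial>N)"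
      if "B \<in> sets (F k)" for B
    proof -
      have [measurable]: "B \<in> sets N" using that sub[of k] by (auto simp: subalgebra_def)
      have "(\<integral>x\<in>B. indicator A (X (Suc k) x) \<partial>N) =
          (\<integral>x\<in>B. real_cond_exp N (F k) (\<lambda>x. indicator A (X (Suc k) x)) x \<partial>N)"
        by (rule F.real_cond_exp_intA[OF intN that])
      also have "\<dots> = (\<integral>x\<in>B. measure (R (X k x)) A \<partial>N)"
        unfolding set_lebesgue_integral_def
        using ae by (intro integral_cong_AE) (auto intro!: borel_measurable_scaleR)
      finally show ?thesis .
    qed
    show ?thesis
    proof (rule HH.real_cond_exp_charact)
      have [measurable]: "(\<lambda>\<omega>. X n (fst \<omega>)) \<in> measurable (N \<Otimes>\<^sub>M T) S" for n by measurable
      show i1: "integrable (N \<Otimes>\<^sub>M T) (\<lambda>\<omega>. indicator A ((X (Suc k) \<circ> fst) \<omega>) :: real)"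
        by (rule P.integrable_const_bound[where B=1]) auto
      show i2: "integrable (N \<Otimes>\<^sub>M T) (\<lambda>\<omega>. measure (R ((X k \<circ> fst) \<omega>)) A)"
        by (rule P.integrable_const_bound[where B=1]) (auto intro!: RX simp: space_pair_measure)
      show "(\<lambda>\<omega>. measure (R ((X k \<circ> fst) \<omega>)) A) \<in> borel_measurable (H k)"
        using measurable_compose[OF XH[of k] Rm] .
      fix C assume C: "C \<in> sets (H k)"
      then have CF: "C \<in> sets (F k \<Otimes>\<^sub>M T)" and [measurable]: "C \<in> sets (N \<Otimes>\<^sub>M T)" using HF FT by auto
      have fubini: "(\<integral>\<omega>\<in>C. f (fst \<omega>) \<partial>(N \<Otimes>\<^sub>M T)) = (\<integral>t. (\<integral>x\<in>((\<lambda>x. (x, t)) -` C). f x \<partial>N) \<partial>T)"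
        if "integrable (N \<Otimes>\<^sub>M T) (\<lambda>\<omega>. f (fst \<omega>))" for f :: "'b \<Rightarrow> real"
      proof -
        have "integrable (N \<Otimes>\<^sub>M T) (\<lambda>(x, t). indicator C (x, t) *\<^sub>R f x)"
          using integrable_mult_indicator[OF \<open>C \<in> sets (N \<Otimes>\<^sub>M T)\<close> that] by (simp add: case_prod_unfold)
        from P.integral_snd[OF this] show ?thesis
          unfolding set_lebesgue_integral_def by (simp add: case_prod_unfold indicator_def)
      qed
      have "(\<integral>x\<in>((\<lambda>x. (x, t)) -` C). indicator A (X (Suc k) x) \<partial>N) =
          (\<integral>x\<in>((\<lambda>x. (x, t)) -` C). measure (R (X k x)) A \<partial>N)" for t
        by (rule slice) (rule sets_Pair2[OF CF])
      then show "(\<integral>\<omega>\<in>C. indicator A ((X (Suc k) \<circ> fst) \<omega>) \<partial>(N \<Otimes>\<^sub>M T)) =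
          (\<integral>\<omega>\<in>C. measure (R ((X k \<circ> fst) \<omega>)) A \<partial>(N \<Otimes>\<^sub>M T))"
        using fubini[of "\<lambda>x. indicator A (X (Suc k) x)"] fubini[of "\<lambda>x. measure (R (X k x)) A"] i1 i2
        by simp
    qed
  qed
  have "distr (N \<Otimes>\<^sub>M T) S (X 0 \<circ> fst) = distr (distr (N \<Otimes>\<^sub>M T) N fst) S (X 0)"
    by (rule distr_distr[symmetric]) measurable
  also have "\<dots> = \<mu>"
    using chain by (simp add: T.distr_pair_fst markov_chain_wrt_def)
  finally have init: "distr (N \<Otimes>\<^sub>M T) S (X 0 \<circ> fst) = \<mu>" .
  show ?thesis
    unfolding markov_chain_wrt_def using H subH XH init cond P.prob_space_axioms by auto
qed

section \<open>One-step equations for the chain and for the urn\<close>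

lemma markov_chain_step:
  assumes R: "R \<in> measurable S (prob_algebra S)"
    and chain: "markov_chain_wrt N F S R \<mu> X" and A[measurable]: "A \<in> sets S"
  shows "(\<integral>\<omega>. indicator A (X (Suc k) \<omega>) \<partial>N) = (\<integral>\<omega>. measure (R (X k \<omega>)) A \<partial>N)"
proof -
  interpret N: prob_space N using chain by (simp add: markov_chain_wrt_def)
  have sub: "subalgebra N (F k)" and XF: "X k \<in> measurable (F k) S" for k
    using chain by (auto simp: markov_chain_wrt_def)
  have [measurable]: "X k \<in> measurable N S" for k
    by (rule measurable_from_subalg[OF sub XF])
  interpret F: finite_measure_subalgebra N "F k" using sub by unfold_locales
  have [measurable]: "(\<lambda>s. measure (R s) A) \<in> borel_measurable S"
    by (rule measurable_kernel_measure[OF R A])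
  have "integrable N (\<lambda>x. indicator A (X (Suc k) x) :: real)"
    by (rule N.integrable_const_bound[where B=1]) auto
  from F.real_cond_exp_int(2)[OF this]
  have "(\<integral>\<omega>. indicator A (X (Suc k) \<omega>) \<partial>N) =
      (\<integral>\<omega>. real_cond_exp N (F k) (\<lambda>\<omega>. indicator A (X (Suc k) \<omega>)) \<omega> \<partial>N)" by simp
  also have "\<dots> = (\<integral>\<omega>. measure (R (X k \<omega>)) A \<partial>N)"
    using chain A by (intro integral_cong_AE) (auto simp: markov_chain_wrt_def)
  finally show ?thesis .
qed

text \<open>Unrolling the replacement rule writes \<open>U n A\<close> as \<open>U0 A\<close> plus
  the sum of the \<open>R (Z i) A\<close>. Taking expectations in the conditional law of
  \<open>Z n\<close> then removes the past and leaves an equation between one-dimensional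
  laws.\<close>

lemma urn_step:
  assumes R: "R \<in> measurable S (prob_algebra S)" and U0: "prob_space U0"
    and urn: "urn_model M S R U0 U Z" and A[measurable]: "A \<in> sets S"
  shows "(real n + 1) * measure (distr M S (Z n)) A =
      measure U0 A + (\<Sum>i<n. \<integral>s. measure (R s) A \<partial>distr M S (Z i))"
proof -
  interpret M: prob_space M using urn by (simp add: urn_model_def)
  interpret U0: prob_space U0 by fact
  have Z[measurable]: "Z n \<in> measurable M S" for n using urn by (simp add: urn_model_def)
  have Rm[measurable]: "(\<lambda>s. measure (R s) A) \<in> borel_measurable S"
    by (rule measurable_kernel_measure[OF R A])
  have RZ: "prob_space (R (Z i \<omega>))" if "\<omega> \<in> space M" for i \<omega>
    using R measurable_space[OF Z that, of i] by (auto simp: space_prob_algebra dest: measurable_space)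
  have intR: "integrable M (\<lambda>\<omega>. measure (R (Z i \<omega>)) A)" for i
    by (rule M.integrable_const_bound[where B=1]) (auto intro!: prob_space.prob_le_1 RZ)
  \<comment> \<open>The model speaks of \<open>emeasure\<close>, which could be infinite; the
    induction proves finiteness together with the formula, and only then is the real-valued
    \<open>measure\<close> read off.\<close>
  have U: "emeasure (U n \<omega>) A = ennreal (measure U0 A + (\<Sum>i<n. measure (R (Z i \<omega>)) A))"
    if "\<omega> \<in> space M" for n \<omega>
  proof (induction n)
    case 0
    show ?case using urn that by (simp add: urn_model_def U0.emeasure_eq_measure)
  next
    case (Suc n)
    interpret RZ: prob_space "R (Z n \<omega>)" by (rule RZ) fact
    have "emeasure (U (Suc n) \<omega>) A = emeasure (U n \<omega>) A + emeasure (R (Z n \<omega>)) A"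
      using urn that A by (simp add: urn_model_def)
    then show ?case
      by (simp add: Suc RZ.emeasure_eq_measure ennreal_plus[symmetric] sum_nonneg add.assoc del: ennreal_plus)
  qed
  have mU: "measure (U n \<omega>) A = measure U0 A + (\<Sum>i<n. measure (R (Z i \<omega>)) A)"
    if "\<omega> \<in> space M" for \<omega>
    unfolding measure_def[of "U n \<omega>"] U[OF that] by (rule enn2real_ennreal) (intro add_nonneg_nonneg sum_nonneg measure_nonneg)
  have "subalgebra M (gen_sigma M S {..<n} Z)"
    using sets_gen_sigma_subset[of M M "{..<n}" Z S] by (auto simp: subalgebra_def)
  then interpret F: finite_measure_subalgebra M "gen_sigma M S {..<n} Z" by unfold_locales
  have "integrable M (\<lambda>x. indicator A (Z n x) :: real)"
    by (rule M.integrable_const_bound[where B=1]) auto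
  from F.real_cond_exp_int(2)[OF this]
  have "(\<integral>\<omega>. indicator A (Z n \<omega>) \<partial>M) =
      (\<integral>\<omega>. real_cond_exp M (gen_sigma M S {..<n} Z) (\<lambda>\<omega>. indicator A (Z n \<omega>)) \<omega> \<partial>M)" by simp
  also have "\<dots> = (\<integral>\<omega>. (measure U0 A + (\<Sum>i<n. measure (R (Z i \<omega>)) A)) / (real n + 1) \<partial>M)"
  proof (rule integral_cong_AE)
    have "AE \<omega> in M. real_cond_exp M (gen_sigma M S {..<n} Z) (\<lambda>\<omega>. indicator A (Z n \<omega>)) \<omega> =
        measure (U n \<omega>) A / (real n + 1)"
      using urn A by (simp add: urn_model_def)
    then show "AE \<omega> in M. real_cond_exp M (gen_sigma M S {..<n} Z) (\<lambda>\<omega>. indicator A (Z n \<omega>)) \<omega> =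
        (measure U0 A + (\<Sum>i<n. measure (R (Z i \<omega>)) A)) / (real n + 1)"
      using AE_space by eventually_elim (simp add: mU)
  qed measurable
  also have "\<dots> = (measure U0 A + (\<Sum>i<n. \<integral>\<omega>. measure (R (Z i \<omega>)) A \<partial>M)) / (real n + 1)"
    using intR by (simp add: M.prob_space)
  also have "(\<Sum>i<n. \<integral>\<omega>. measure (R (Z i \<omega>)) A \<partial>M) = (\<Sum>i<n. \<integral>s. measure (R s) A \<partial>distr M S (Z i))"
    by (intro sum.cong refl integral_distr[symmetric]) measurable
  also have "(\<integral>\<omega>. indicator A (Z n \<omega>) \<partial>M) = measure (distr M S (Z n)) A"
  proof -
    have "(\<integral>\<omega>. indicator A (Z n \<omega>) \<partial>M) = (\<integral>s. indicator A s \<partial>distr M S (Z n) :: real)"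
      by (subst integral_distr) auto
    then show ?thesis by simp
  qed
  finally show ?thesis by (simp add: field_simps)
qed

section \<open>The laws of the draws\<close>

text \<open>In the difference of \<open>urn_step\<close> at \<open>Suc n\<close> and at
  \<open>n\<close> only the term \<open>i = n\<close> of the sum survives. Division by
  \<open>n + 2\<close> produces the success probability of coin \<open>n\<close>.\<close>

lemma urn_law_Suc:
  assumes R: "R \<in> measurable S (prob_algebra S)" and U0: "prob_space U0"
    and urn: "urn_model M S R U0 U Z" and A: "A \<in> sets S"
  shows "measure (distr M S (Z (Suc n))) A =
      (1 - 1 / (real n + 2)) * measure (distr M S (Z n)) A +
      1 / (real n + 2) * (\<integral>s. measure (R s) A \<partial>distr M S (Z n))"
proof -
  have "(real n + 2) * measure (distr M S (Z (Suc n))) A =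
      (real n + 1) * measure (distr M S (Z n)) A + (\<integral>s. measure (R s) A \<partial>distr M S (Z n))"
    using urn_step[OF R U0 urn A, of n] urn_step[OF R U0 urn A, of "Suc n"]
    by (simp add: add.commute)
  moreover have "1 - 1 / (real n + 2) = (real n + 1) / (real n + 2)" by (simp add: field_simps)
  moreover have "real n + 2 \<noteq> 0" by simp
  ultimately show ?thesis
    by (metis add_divide_distrib mult.left_neutral nonzero_mult_div_cancel_left times_divide_eq_left)
qed

text \<open>The coins are frozen first, which makes the random time deterministic inside the inner
  integral over \<open>N\<close>.\<close>

lemma integral_at_successes:
  fixes f :: "'s \<Rightarrow> real"
  assumes N: "prob_space N" and X[measurable]: "\<And>n. X n \<in> measurable N S"
    and f[measurable]: "f \<in> borel_measurable S" and bound: "\<And>s. s \<in> space S \<Longrightarrow> \<bar>f s\<bar> \<le> 1"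
  shows "(\<integral>\<omega>. f (X (successes n (snd \<omega>)) (fst \<omega>)) \<partial>(N \<Otimes>\<^sub>M coin_space)) =
      (\<integral>t. (\<integral>x. f (X (successes n t) x) \<partial>N) \<partial>coin_space)"
proof -
  interpret N: prob_space N by fact
  interpret P: pair_prob_space N coin_space ..
  have "integrable (N \<Otimes>\<^sub>M coin_space) (\<lambda>(x, t). f (X (successes n t) x))"
  proof (rule P.integrable_const_bound[where B=1])
    show "AE \<omega> in N \<Otimes>\<^sub>M coin_space. norm (case \<omega> of (x, t) \<Rightarrow> f (X (successes n t) x)) \<le> 1"
      using measurable_space[OF X] by (intro AE_I2) (auto simp: space_pair_measure intro!: bound)
  qed measurable
  from P.integral_snd[OF this] show ?thesis by (simp add: case_prod_unfold)
qed

text \<open>Failure of coin \<open>n\<close> leaves the time unchanged, and success advances it by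
  one, which by \<open>markov_chain_step\<close> applies the kernel once. The form matches
  \<open>urn_law_Suc\<close>.\<close>

lemma distr_chain_at_successes_Suc:
  fixes X :: "nat \<Rightarrow> 'b \<Rightarrow> 's"
  assumes R: "R \<in> measurable S (prob_algebra S)"
    and chain: "markov_chain_wrt N F S R \<mu> X" and A[measurable]: "A \<in> sets S"
    and X[measurable]: "\<And>n. X n \<in> measurable N S"
  defines "\<nu> \<equiv> \<lambda>n. distr (N \<Otimes>\<^sub>M coin_space) S (\<lambda>\<omega>. X (successes n (snd \<omega>)) (fst \<omega>))"
  shows "measure (\<nu> (Suc n)) A =
      (1 - 1 / (real n + 2)) * measure (\<nu> n) A +
      1 / (real n + 2) * (\<integral>s. measure (R s) A \<partial>\<nu> n)"
proof -
  have N: "prob_space N" using chain by (simp add: markov_chain_wrt_def)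
  have [measurable]: "(\<lambda>s. measure (R s) A) \<in> borel_measurable S"
    by (rule measurable_kernel_measure[OF R A])
  have [measurable]: "(\<lambda>\<omega>. X (successes n (snd \<omega>)) (fst \<omega>)) \<in> measurable (N \<Otimes>\<^sub>M coin_space) S" for n
    by measurable
  have integral_\<nu>: "(\<integral>s. f s \<partial>\<nu> n) = (\<integral>t. (\<integral>x. f (X (successes n t) x) \<partial>N) \<partial>coin_space)"
    if [measurable]: "f \<in> borel_measurable S" and "\<And>s. s \<in> space S \<Longrightarrow> \<bar>f s\<bar> \<le> 1" for f :: "'s \<Rightarrow> real" and n
    unfolding \<nu>_def using that integral_at_successes[OF N X that] by (subst integral_distr) auto
  have measure_\<nu>: "measure (\<nu> n) A = (\<integral>t. (\<integral>x. indicator A (X (successes n t) x) \<partial>N) \<partial>coin_space)" for n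
  proof -
    have "measure (\<nu> n) A = (\<integral>s. indicator A s \<partial>\<nu> n)" by (simp add: \<nu>_def)
    then show ?thesis by (subst (asm) integral_\<nu>) auto
  qed
  have "measure (\<nu> (Suc n)) A = (1 - 1 / (real n + 2)) * measure (\<nu> n) A +
      1 / (real n + 2) * (\<integral>t. (\<integral>x. indicator A (X (Suc (successes n t)) x) \<partial>N) \<partial>coin_space)"
    unfolding measure_\<nu>
    using expectation_successes_Suc[of "\<lambda>k. (\<integral>x. indicator A (X k x) \<partial>N) :: real" n] by simp
  \<comment> \<open>For each frozen \<open>t\<close> the time \<open>successes n t\<close> is a
    constant, so the one-step identity applies under the outer integral.\<close>
  also have "(\<integral>t. (\<integral>x. indicator A (X (Suc (successes n t)) x) \<partial>N) \<partial>coin_space) = (\<integral>s. measure (R s) A \<partial>\<nu> n)"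
    unfolding markov_chain_step[OF R chain A]
    by (rule integral_\<nu>[symmetric]) (auto intro!: kernel_measure_le_1[OF R])
  finally show ?thesis .
qed

text \<open>Both families of laws start at \<open>U0\<close> and obey the same recursion, whose
  right-hand side depends only on the law at \<open>n\<close>. The marginals are compared, not the
  joint laws of the two processes.\<close>

lemma urn_law_eq_chain_at_successes:
  fixes X :: "nat \<Rightarrow> 'b \<Rightarrow> 's"
  assumes R: "R \<in> measurable S (prob_algebra S)"
    and U0: "prob_space U0"
    and urn: "urn_model M S R U0 U Z"
    and chain: "markov_chain_wrt N F S R U0 X"
    and X[measurable]: "\<And>n. X n \<in> measurable N S"
  shows "distr M S (Z n) = distr (N \<Otimes>\<^sub>M coin_space) S (\<lambda>\<omega>. X (successes n (snd \<omega>)) (fst \<omega>))"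
proof -
  interpret M: prob_space M using urn by (simp add: urn_model_def)
  interpret N: prob_space N using chain by (simp add: markov_chain_wrt_def)
  interpret P: pair_prob_space N coin_space ..
  have Z[measurable]: "Z n \<in> measurable M S" for n using urn by (simp add: urn_model_def)
  let ?\<nu> = "\<lambda>n. distr (N \<Otimes>\<^sub>M coin_space) S (\<lambda>\<omega>. X (successes n (snd \<omega>)) (fst \<omega>))"
  have eqI: "distr M S (Z n) = ?\<nu> n"
    if "\<And>A. A \<in> sets S \<Longrightarrow> measure (distr M S (Z n)) A = measure (?\<nu> n) A" for n
  proof (rule measure_eqI)
    interpret Zn: prob_space "distr M S (Z n)" by (rule M.prob_space_distr) measurable
    interpret \<nu>n: prob_space "?\<nu> n" by (rule P.prob_space_distr) measurable
    show "emeasure (distr M S (Z n)) A = emeasure (?\<nu> n) A" if "A \<in> sets (distr M S (Z n))" for A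
      using that \<open>\<And>A. A \<in> sets S \<Longrightarrow> _ A = _ A\<close>[of A]
      by (simp only: Zn.emeasure_eq_measure \<nu>n.emeasure_eq_measure sets_distr)
  qed simp
  show ?thesis
  proof (induction n)
    case 0
    show ?case
    proof (rule eqI)
      fix A assume A: "A \<in> sets S"
      have "?\<nu> 0 = distr (distr (N \<Otimes>\<^sub>M coin_space) N fst) S (X 0)"
        by (subst distr_distr) (auto simp: comp_def)
      also have "\<dots> = U0"
        using chain by (simp add: coin_space.distr_pair_fst markov_chain_wrt_def)
      finally show "measure (distr M S (Z 0)) A = measure (?\<nu> 0) A"
        using urn_step[OF R U0 urn A, of 0] by simp
    qed
  next
    case (Suc n)
    show ?case
      by (rule eqI)
         (simp only: urn_law_Suc[OF R U0 urn] distr_chain_at_successes_Suc[OF R chain _ X] Suc)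
  qed
qed

section \<open>Assembly on the product of the chain space and the coin space\<close>

theorem theorem2p2:
  fixes S :: "'s measure" and R :: "'s \<Rightarrow> 's measure" and U0 :: "'s measure"
    and M :: "'a measure" and U :: "nat \<Rightarrow> 'a \<Rightarrow> 's measure" and Z :: "nat \<Rightarrow> 'a \<Rightarrow> 's"
    and N :: "'b measure" and X :: "nat \<Rightarrow> 'b \<Rightarrow> 's"
  assumes "space S \<noteq> {}"
    and "R \<in> measurable S (prob_algebra S)"
    and "prob_space U0" and "sets U0 = sets S"
    and "urn_model M S R U0 U Z"
    and "markov_chain N S R U0 X"
  shows "\<exists>(N' :: ('b \<times> (nat \<Rightarrow> nat)) measure) \<pi> X' \<tau>.
     prob_extension N N' \<pi> \<and> X' = (\<lambda>n. X n \<circ> \<pi>) \<and>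
     (\<forall>n. \<tau> n \<in> measurable N' (count_space UNIV)) \<and>
     (\<forall>\<omega>\<in>space N'. \<tau> 0 \<omega> = 0 \<and> mono (\<lambda>n. \<tau> n \<omega>)) \<and>
     indep_sequences N' S X' (count_space UNIV) \<tau> \<and>
     (\<forall>n. stopping_time (enlarged_filtration N' S X' \<tau>) (\<tau> n)) \<and>
     markov_chain_wrt N' (enlarged_filtration N' S X' \<tau>) S R U0 X' \<and>
     (\<forall>n. distr M S (Z n) = distr N' S (\<lambda>\<omega>. X' (\<tau> n \<omega>) \<omega>)) \<and>
     (AE \<omega> in N'. (\<lambda>n. real (\<tau> n \<omega>) / ln (real n)) \<longlonglongrightarrow> 1) \<and>
     weak_conv_m
       (\<lambda>n. distr N' borel (\<lambda>\<omega>. (real (\<tau> n \<omega>) - ln (real n)) / sqrt (ln (real n))))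
       std_normal_distribution"
proof -
  note R = assms(2)
  \<comment> \<open>The chain is read from the first factor and the coins from the second, so
    \<open>fst\<close> is the projection of the extension and independence is built in.\<close>
  let ?N' = "N \<Otimes>\<^sub>M coin_space"
  let ?X' = "\<lambda>n. X n \<circ> fst"
  let ?\<tau> = "\<lambda>n. successes n \<circ> snd"
  let ?F = "\<lambda>k. gen_sigma N S {..k} X"
  let ?H = "enlarged_filtration ?N' S ?X' ?\<tau>"
  have chain: "markov_chain_wrt N ?F S R U0 X"
    using assms(6) by (simp add: markov_chain_def)
  interpret N: prob_space N using chain by (simp add: markov_chain_wrt_def)
  interpret P: pair_prob_space N coin_space ..
  have X[measurable]: "X n \<in> measurable N S" for n
    using chain by (auto simp: markov_chain_wrt_def intro: measurable_from_subalg)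
  have spaceX: "X n x \<in> space S" if "x \<in> space N" for n x
    using measurable_space[OF X that] .
  have X': "?X' \<in> UNIV \<rightarrow> space ?N' \<rightarrow> space S"
    by (auto simp: space_pair_measure intro: spaceX)
  have ext: "prob_extension N ?N' fst"
    by (simp add: prob_extension_def P.prob_space_axioms coin_space.distr_pair_fst)
  have markov: "markov_chain_wrt ?N' ?H S R U0 ?X'"
  proof (rule markov_chain_wrt_pair[OF R coin_space.prob_space_axioms chain])
    show "filtration (space ?N') ?H" by (rule filtration_enlarged_filtration[OF X'])
    show "?X' k \<in> measurable (?H k) S" for k
      by (rule measurable_enlarged_filtration(1)[OF X']) simp
    \<comment> \<open>The coin factor enters with its full \<sigma>-algebra at every
      \<open>k\<close>, matching a filtration that knows all of \<open>?\<tau>\<close> from the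
      start.\<close>
    show "sets (?H k) \<subseteq> sets (?F k \<Otimes>\<^sub>M coin_space)" for k
    proof (rule sets_enlarged_filtration_subset)
      show "?X' i \<in> measurable (?F k \<Otimes>\<^sub>M coin_space) S" if "i \<le> k" for i
        using that by (intro measurable_comp[OF measurable_fst] measurable_gen_sigma) (auto intro: spaceX)
      show "?\<tau> n \<in> measurable (?F k \<Otimes>\<^sub>M coin_space) (count_space UNIV)" for n
        by measurable
    qed (simp add: space_pair_measure)
  qed
  have law: "distr M S (Z n) = distr ?N' S (\<lambda>\<omega>. ?X' (?\<tau> n \<omega>) \<omega>)" for n
    using urn_law_eq_chain_at_successes[OF R assms(3,5) chain X] by (simp add: comp_def)
  have snd_eq: "distr ?N' coin_space snd = coin_space"
  proof -
    \<comment> \<open>Swapping the factors turns the second marginal into a first marginal.\<close>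
    have "distr ?N' coin_space snd = distr (distr (coin_space \<Otimes>\<^sub>M N) ?N' (\<lambda>(x, y). (y, x))) coin_space snd"
      by (subst P.distr_pair_swap) simp
    also have "\<dots> = distr (coin_space \<Otimes>\<^sub>M N) coin_space fst"
      by (subst distr_distr) (auto simp: comp_def case_prod_unfold)
    finally show ?thesis by (simp add: N.distr_pair_fst)
  qed
  \<comment> \<open>Both limits concern the coins alone and are carried over to the product along
    \<open>snd\<close>.\<close>
  have "AE \<omega> in distr ?N' coin_space snd. (\<lambda>n. real (successes n \<omega>) / ln (real n)) \<longlonglongrightarrow> 1"
    unfolding snd_eq by (rule AE_successes_over_ln)
  then have lln: "AE \<omega> in ?N'. (\<lambda>n. real (?\<tau> n \<omega>) / ln (real n)) \<longlonglongrightarrow> 1"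
    by (auto dest!: AE_distrD[OF measurable_snd])
  have "distr ?N' borel (\<lambda>\<omega>. (real (?\<tau> n \<omega>) - ln (real n)) / sqrt (ln (real n))) =
      distr coin_space borel (\<lambda>\<omega>. (real (successes n \<omega>) - ln (real n)) / sqrt (ln (real n)))" for n
    by (subst (2) snd_eq[symmetric], subst distr_distr) (auto simp: comp_def)
  then have clt: "weak_conv_m
       (\<lambda>n. distr ?N' borel (\<lambda>\<omega>. (real (?\<tau> n \<omega>) - ln (real n)) / sqrt (ln (real n)))) std_normal_distribution"
    using weak_conv_successes_normalized by simp
  show ?thesis
  proof (intro exI conjI)
    show "prob_extension N ?N' fst" by (rule ext)
    show "(\<lambda>n. X n \<circ> fst) = (\<lambda>n. X n \<circ> fst)" ..
    show "\<forall>n. ?\<tau> n \<in> measurable ?N' (count_space UNIV)" by measurable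
    show "\<forall>\<omega>\<in>space ?N'. ?\<tau> 0 \<omega> = 0 \<and> mono (\<lambda>n. ?\<tau> n \<omega>)" by (simp add: mono_successes)
    show "indep_sequences ?N' S ?X' (count_space UNIV) ?\<tau>"
      by (rule indep_sequences_pair[OF N.prob_space_axioms coin_space.prob_space_axioms]) measurable
    show "\<forall>n. stopping_time ?H (?\<tau> n)"
      by (intro allI stopping_time_enlarged_filtration[where \<tau>="?\<tau>"])
  qed (use markov law lln clt in \<open>auto simp only:\<close>)
qed

end
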